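(* For every integer $n\ge 1$, the competition complexity $\mathrm{CC}(n,\mathcal F_{\mathrm{MHR}})$ of the VCG auction for the $n$-unit $n$-buyer (balanced) market over the class $\mathcal F_{\mathrm{MHR}}$ of MHR distributions (with target approximation ratio $1$) satisfies $$\left(e^{1/e}-1\right)\cdot n\;\le\;\mathrm{CC}(n,\mathcal F_{\mathrm{MHR}})\;\le\;\left\lceil \left(e^{1/e}-1\right)\cdot n+1.05\,\ln n\right\rceil .$$
   Context: Distributions. A valuation distribution $F$ is a probability distribution on $[0,\infty)$; $F$ also denotes its CDF with the convention $F(v)=\Pr_{x\sim F}[x<v]$. Its support is an interval on which it has a density $f$, except that an atom at the right endpoint of the support is allowed (in particular point masses are allowed). It is assumed that some price $p\in\mathrm{supp}(F)$ maximizes $p\,(1-F(p))$ over $p\ge 0$; such a maximizer is called a monopoly reserve $r^*$. $F$ is MHR (monotone hazard rate) if the hazard rate $f(v)/(1-F(v))$ is non-decreasing in $v$ on the support (excluding the possible atom at its right endpoint). $\mathcal F_{\mathrm{MHR}}$ is the class of MHR distributions. Mechanisms. In an $m$-unit, $N$-buyer market ($m\le N$) the buyers have unit demand and values drawn i.i.d. from $F$; all bid truthfully. The VCG auction gives one unit to each of the $m$ highest-valued buyers (ties broken arbitrarily) and each winner pays the $(m+1)$-th highest value (taken to be $0$ if $N=m$). $\mathrm{RevVCG}_{m:N}(F)$ is its expected total payment. The Bayesian-optimal mechanism with monopoly reserve $r^*$ gives one unit to each of the $m$ highest-valued buyers whose value is at least $r^*$; each winner pays the maximum of $r^*$ and the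 $(m+1)$-th highest value. $\mathrm{RevOPT}_{m:N}(F)$ is its expected total payment (for $m=N$ it equals $N\cdot\max_p p(1-F(p))$). Competition complexity. $\mathrm{CC}(n,\mathcal F)=\min\{k\in\mathbb Z_{\ge 0}:\ \forall F\in\mathcal F,\ \mathrm{RevVCG}_{n:n+k}(F)\ge \mathrm{RevOPT}_{n:n}(F)\}$ (and $\infty$ if no such $k$ exists). *)

theory Defs
  imports "HOL-Probability.Probability"
begin

text \<open>A value distribution is a probability measure on the Borel sets of the reals. Following the
  auction literature its distribution function uses a strict inequality, so that
  \<open>1 - dist_fun F p\<close> is the probability that a buyer accepts the price \<open>p\<close>
  (the library's \<open>cdf\<close> is the non-strict version).\<close>

definition dist_fun :: "real measure \<Rightarrow> real \<Rightarrow> real" where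
  "dist_fun F v = measure F {..<v}"

definition supp :: "real measure \<Rightarrow> real set" where
  "supp F = {x. \<forall>U. open U \<and> x \<in> U \<longrightarrow> emeasure F U > 0}"

text \<open>The support without its right endpoint (if it has one). This is where a density is required:
  the right endpoint may carry an atom, and if it does not, then the hazard rate is undefined
  there because \<open>1 - dist_fun F\<close> vanishes.\<close>

definition supp_body :: "real measure \<Rightarrow> real set" where
  "supp_body F = {x \<in> supp F. \<exists>y \<in> supp F. x < y}"

definition has_density :: "real measure \<Rightarrow> (real \<Rightarrow> real) \<Rightarrow> bool" where
  "has_density F f \<longleftrightarrow>
     f \<in> borel_measurable borel \<and> (\<forall>x. 0 \<le> f x) \<and>
     (\<forall>A \<in> sets borel. A \<subseteq> supp_body F \<longrightarrow> emeasure F A = (\<integral>\<^sup>+x\<in>A. ennreal (f x) \<partial>lborel))"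

definition is_monopoly_reserve :: "real measure \<Rightarrow> real \<Rightarrow> bool" where
  "is_monopoly_reserve F r \<longleftrightarrow>
     r \<in> supp F \<and> (\<forall>p\<ge>0. p * (1 - dist_fun F p) \<le> r * (1 - dist_fun F r))"

definition valuation_distribution :: "real measure \<Rightarrow> bool" where
  "valuation_distribution F \<longleftrightarrow>
     prob_space F \<and> sets F = sets borel \<and> (AE x in F. 0 \<le> x) \<and>
     is_interval (supp F) \<and> (\<exists>f. has_density F f) \<and> (\<exists>r. is_monopoly_reserve F r)"

text \<open>A density is only determined up to null sets, so some version of it is required to have a
  non-decreasing hazard rate.\<close>

definition MHR :: "real measure set" where
  "MHR = {F. valuation_distribution F \<and>
     (\<exists>f. has_density F f \<and> mono_on (supp_body F) (\<lambda>v. f v / (1 - dist_fun F v)))}"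

text \<open>The \<open>k\<close>-th highest (counting from 1) of the values \<open>v 0, \<dots>, v (N - 1)\<close>, and \<open>0\<close> if \<open>k > N\<close>.\<close>

definition kth_highest :: "nat \<Rightarrow> (nat \<Rightarrow> real) \<Rightarrow> nat \<Rightarrow> real" where
  "kth_highest N v k = (if 1 \<le> k \<and> k \<le> N then rev (sort (map v [0..<N])) ! (k - 1) else 0)"

text \<open>Total payments are summed over the ranks \<open>j = 1, \<dots>, m\<close> of the \<open>m\<close> highest-valued buyers;
  they do not depend on how ties are broken.\<close>

definition vcg_payment :: "nat \<Rightarrow> nat \<Rightarrow> (nat \<Rightarrow> real) \<Rightarrow> real" where
  "vcg_payment m N v = (\<Sum>j=1..m. kth_highest N v (m + 1))"

definition reserve_payment :: "real \<Rightarrow> nat \<Rightarrow> nat \<Rightarrow> (nat \<Rightarrow> real) \<Rightarrow> real" where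
  "reserve_payment r m N v =
     (\<Sum>j=1..m. if r \<le> kth_highest N v j then max r (kth_highest N v (m + 1)) else 0)"

text \<open>Payments are almost surely non-negative, so expected revenue is taken in the extended
  non-negative reals and needs no integrability side condition.\<close>

definition RevVCG :: "nat \<Rightarrow> nat \<Rightarrow> real measure \<Rightarrow> ennreal" where
  "RevVCG m N F = (\<integral>\<^sup>+v. ennreal (vcg_payment m N v) \<partial>(Pi\<^sub>M {..<N} (\<lambda>_. F)))"

text \<open>The reserve used is an arbitrary maximizer; for \<open>m = N\<close> the revenue is
  \<open>N * r * (1 - dist_fun F r)\<close>, which is the same for all of them.\<close>

definition monopoly_reserve :: "real measure \<Rightarrow> real" where
  "monopoly_reserve F = (SOME r. is_monopoly_reserve F r)"

definition RevOPT :: "nat \<Rightarrow> nat \<Rightarrow> real measure \<Rightarrow> ennreal" where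
  "RevOPT m N F =
     (\<integral>\<^sup>+v. ennreal (reserve_payment (monopoly_reserve F) m N v) \<partial>(Pi\<^sub>M {..<N} (\<lambda>_. F)))"

text \<open>In \<open>enat\<close> the infimum of a non-empty set is its minimum, and \<open>Inf {} = \<infinity>\<close>.\<close>

definition CC :: "nat \<Rightarrow> real measure set \<Rightarrow> enat" where
  "CC n C = Inf (enat ` {k. \<forall>F \<in> C. RevVCG n (n + k) F \<ge> RevOPT n n F})"

end

theory Submission imports Defs begin

text \<open>If \<open>N = n + k\<close> values are drawn, the \<open>(n + 1)\<close>-st highest value has expectation
  \<open>\<integral> q (S t) dt\<close>, where \<open>S t\<close> is the probability that a buyer accepts the price \<open>t\<close> and
  \<open>q p\<close> is the probability that a binomial variable with parameters \<open>N\<close> and \<open>p\<close> is at least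
  \<open>n + 1\<close>; \<open>q\<close> is also the distribution function of \<open>U \<sim> Beta(n + 1, k)\<close>. Monotone hazard rate
  makes \<open>ln S\<close> concave, so \<open>S t \<ge> S r powr (t / r)\<close> up to the reserve \<open>r\<close>, and optimality of \<open>r\<close>
  gives \<open>S r = exp (- a)\<close> with \<open>a \<le> 1\<close>. Hence VCG with \<open>k\<close> extra buyers is good enough once
  \<open>E[min a (- ln U)] \<ge> a * exp (- a)\<close> for all \<open>0 < a \<le> 1\<close>.

  For \<open>n \<ge> 3\<close> this follows by integrating minorants of \<open>min a (- ln u)\<close> whose moments are explicit:
  \<open>a - a\<^sup>2 / 4 * (1 / (1 - u) - 1 / 2)\<close> for \<open>a \<le> 0.7\<close>, and for larger \<open>a\<close> a quadratic around
  \<open>u = exp (- 1 / e)\<close>, the point where \<open>- ln u\<close> equals the maximum \<open>1 / e\<close> of \<open>a * exp (- a)\<close>. For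
  \<open>n \<le> 2\<close> the pointwise bound \<open>q (exp (- x)) \<ge> exp (- 2 * x) \<ge> (1 - x) * exp (- x)\<close> suffices.

  For the lower bound take the exponential distribution. There the revenue per unit is
  \<open>E[- ln U] \<le> ln (E[1 / U]) = ln ((n + k) / n)\<close> by Jensen, and it has to reach \<open>1 / e\<close>.\<close>

subsection \<open>Revenue as an integral of binomial tails\<close>

text \<open>In an ascending list the entries that are at least \<open>t\<close> form a final
  segment, so the \<open>k\<close>-th entry from the end belongs to it exactly when the segment has
  at least \<open>k\<close> elements.\<close>

lemma sorted_nth_ge_iff:
  fixes ys :: "'a::linorder list"
  assumes "sorted ys" "1 \<le> k" "k \<le> length ys"
  shows "t \<le> ys ! (length ys - k) \<longleftrightarrow> k \<le> length (filter (\<lambda>x. t \<le> x) ys)"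
proof -
  let ?A = "{i. i < length ys \<and> t \<le> ys ! i}"
  have len: "length (filter (\<lambda>x. t \<le> x) ys) = card ?A"
    by (simp add: length_filter_conv_card)
  show ?thesis
  proof
    assume "t \<le> ys ! (length ys - k)"
    then have "{length ys - k..<length ys} \<subseteq> ?A"
      using sorted_nth_mono[OF assms(1)] by fastforce
    then have "card {length ys - k..<length ys} \<le> card ?A"
      by (intro card_mono) auto
    then show "k \<le> length (filter (\<lambda>x. t \<le> x) ys)" using assms len by simp
  next
    assume le: "k \<le> length (filter (\<lambda>x. t \<le> x) ys)"
    show "t \<le> ys ! (length ys - k)"
    proof (rule ccontr)
      assume less: "\<not> t \<le> ys ! (length ys - k)"
      have "?A \<subseteq> {length ys - k<..<length ys}"
      proof
        fix i assume i: "i \<in> ?A"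
        have "length ys - k < length ys" using assms(2,3) by linarith
        then have "\<not> i \<le> length ys - k"
          using sorted_nth_mono[OF assms(1), of i "length ys - k"] i less
          by (auto dest: order_trans[of t "ys ! i"])
        with i show "i \<in> {length ys - k<..<length ys}" by auto
      qed
      then have "card ?A \<le> card {length ys - k<..<length ys}" by (intro card_mono) auto
      then show False using le len assms by simp
    qed
  qed
qed

lemma length_filter_kth:
  "length (filter P (rev (sort (map v [0..<N])))) = card {i. i < N \<and> P (v i)}"
proof -
  have "length (filter P (rev (sort (map v [0..<N])))) = size (filter_mset P (mset (map v [0..<N])))"
    by (metis mset_filter mset_rev mset_sort size_mset)
  also have "\<dots> = length (filter P (map v [0..<N]))" by (metis mset_filter size_mset)
  also have "\<dots> = card {i. i < N \<and> P (v i)}"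
    by (simp add: length_filter_conv_card cong: conj_cong)
  finally show ?thesis .
qed

text \<open>Turns an event about an order statistic into one about the number of buyers accepting
  the price \<open>t\<close>, which is binomial for independent values.\<close>

lemma kth_highest_ge_iff:
  assumes "1 \<le> k" "k \<le> N"
  shows "t \<le> kth_highest N v k \<longleftrightarrow> k \<le> card {i. i < N \<and> t \<le> v i}"
proof -
  let ?ys = "sort (map v [0..<N])"
  have "kth_highest N v k = ?ys ! (N - k)"
    using assms by (simp add: kth_highest_def rev_nth)
  moreover have "length (filter (\<lambda>x. t \<le> x) ?ys) = card {i. i < N \<and> t \<le> v i}"
    using length_filter_kth[of "\<lambda>x. t \<le> x" v N] by (simp add: rev_filter[symmetric])
  ultimately show ?thesis using sorted_nth_ge_iff[of ?ys k t] assms by simp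
qed

text \<open>With as many units as buyers, the \<open>n + 1\<close>-st highest value takes its
  default 0, so every winner pays exactly \<open>r\<close>.\<close>

lemma reserve_payment_balanced:
  assumes "0 \<le> r"
  shows "reserve_payment r n n v = r * card {i. i < n \<and> r \<le> v i}"
proof -
  let ?xs = "rev (sort (map v [0..<n]))"
  have "reserve_payment r n n v = (\<Sum>j=1..n. if r \<le> ?xs ! (j - 1) then r else 0)"
    unfolding reserve_payment_def using assms by (intro sum.cong) (auto simp: kth_highest_def)
  also have "\<dots> = (\<Sum>j<n. if r \<le> ?xs ! j then r else 0)"
    by (rule sum.reindex_bij_witness[of _ Suc "\<lambda>j. j - 1"]) auto
  also have "\<dots> = r * card {j. j < n \<and> r \<le> ?xs ! j}"
    by (simp add: sum.If_cases Int_def conj_commute lessThan_def)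
  also have "card {j. j < n \<and> r \<le> ?xs ! j} = card {i. i < n \<and> r \<le> v i}"
    using length_filter_kth[of "\<lambda>x. r \<le> x" v n] by (simp add: length_filter_conv_card)
  finally show ?thesis .
qed

section \<open>Distribution of the number of buyers who accept a price\<close>

definition binomial_tail :: "nat \<Rightarrow> nat \<Rightarrow> real \<Rightarrow> real" where
  "binomial_tail N m p = (\<Sum>j=m..N. real (N choose j) * p ^ j * (1 - p) ^ (N - j))"

lemma emeasure_PiM_count_ge:
  fixes F :: "real measure"
  assumes "prob_space F" and [measurable_cong]: "sets F = sets borel"
  shows "emeasure (Pi\<^sub>M {..<N} (\<lambda>_. F)) {v \<in> space (Pi\<^sub>M {..<N} (\<lambda>_. F)). m \<le> card {i. i < N \<and> t \<le> v i}}
    = ennreal (binomial_tail N m (measure F {t..}))" (is "emeasure ?M ?E = _")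
proof -
  interpret F: prob_space F by fact
  interpret finite_product_prob_space "\<lambda>_::nat. F" "{..<N}" by unfold_locales auto
  interpret P: prob_space ?M by (intro prob_space_PiM assms(1))
  let ?p = "measure F {t..}"
  have sF: "space F = UNIV" using sets_eq_imp_space_eq[OF assms(2)] by simp
  have sub: "{..<t} = space F - {t..}" using sF by auto
  have p': "measure F {..<t} = 1 - ?p"
    unfolding sub by (rule F.prob_compl) (simp add: assms(2))
  \<comment> \<open>\<open>B J\<close> is the event that \<open>J\<close> is exactly the set of
    buyers accepting \<open>t\<close>. These boxes are disjoint, and their product measure depends
    on \<open>card J\<close> only.\<close>
  define B where "B J = (\<Pi>\<^sub>E i\<in>{..<N}. if i \<in> J then {t..} else {..<t})" for J
  have Bset: "B J \<in> sets ?M" for J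
    unfolding B_def by (intro sets_PiM_I_finite) (auto simp: assms(2))
  have Bm: "measure ?M (B J) = ?p ^ card J * (1 - ?p) ^ (N - card J)" if "J \<subseteq> {..<N}" for J
  proof -
    have "measure ?M (B J) = (\<Prod>i<N. measure F (if i \<in> J then {t..} else {..<t}))"
      unfolding B_def by (intro finite_measure_PiM_emb) (auto simp: assms(2))
    also have "\<dots> = (\<Prod>i<N. if i \<in> J then ?p else 1 - ?p)"
      by (intro prod.cong) (auto simp: p')
    also have "\<dots> = ?p ^ card ({..<N} \<inter> J) * (1 - ?p) ^ card ({..<N} \<inter> - J)"
      by (subst prod.If_cases) (auto simp: )
    also have "{..<N} \<inter> J = J" using that by auto
    also have "card ({..<N} \<inter> - J) = N - card J"
      using that by (simp add: card_Diff_subset finite_subset flip: Diff_eq)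
    finally show ?thesis .
  qed
  let ?J = "{J. J \<subseteq> {..<N} \<and> m \<le> card J}"
  have finJ: "finite ?J" by (rule finite_subset[of _ "Pow {..<N}"]) auto
  have mem: "v \<in> B J \<longleftrightarrow> v \<in> space ?M \<and> J = {i. i < N \<and> t \<le> v i}" if "J \<subseteq> {..<N}" for v J
    using that by (auto simp: B_def space_PiM sF PiE_iff not_le split: if_splits) (metis lessThan_iff not_le)
  have E: "?E = (\<Union>J\<in>?J. B J)"
    using mem by auto
  have "measure ?M ?E = (\<Sum>J\<in>?J. measure ?M (B J))"
    unfolding E using finJ Bset
    by (intro P.finite_measure_finite_Union) (auto simp: disjoint_family_on_def mem)
  also have "\<dots> = (\<Sum>J\<in>?J. ?p ^ card J * (1 - ?p) ^ (N - card J))"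
    by (intro sum.cong) (auto simp: Bm)
  also have "\<dots> = (\<Sum>j\<in>{m..N}. \<Sum>J\<in>{J\<in>?J. card J = j}. ?p ^ card J * (1 - ?p) ^ (N - card J))"
    using finJ by (intro sum.group[symmetric]) (auto intro: card_mono[of "{..<N}", simplified])
  also have "\<dots> = binomial_tail N m ?p"
    unfolding binomial_tail_def
  proof (intro sum.cong refl)
    fix j assume j: "j \<in> {m..N}"
    then have "{J\<in>?J. card J = j} = {J. J \<subseteq> {..<N} \<and> card J = j}" by auto
    then have "card {J\<in>?J. card J = j} = N choose j" using n_subsets[of "{..<N}" j] by simp
    moreover have "(\<Sum>J\<in>{J\<in>?J. card J = j}. ?p ^ card J * (1 - ?p) ^ (N - card J))
      = (\<Sum>J\<in>{J\<in>?J. card J = j}. ?p ^ j * (1 - ?p) ^ (N - j))"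
      by (intro sum.cong) auto
    ultimately show "(\<Sum>J\<in>{J\<in>?J. card J = j}. ?p ^ card J * (1 - ?p) ^ (N - card J))
      = real (N choose j) * ?p ^ j * (1 - ?p) ^ (N - j)" by simp
  qed
  finally show ?thesis by (simp add: P.emeasure_eq_measure)
qed

text \<open>A nonnegative value is the length of the interval from 0 to it; Tonelli then swaps the
  integrals. Negative values of \<open>V\<close> contribute 0 on both sides.\<close>

lemma nn_integral_layer_cake:
  fixes V :: "'a \<Rightarrow> real"
  assumes "sigma_finite_measure M" and [measurable]: "V \<in> borel_measurable M"
  shows "(\<integral>\<^sup>+x. ennreal (V x) \<partial>M) = (\<integral>\<^sup>+t\<in>{0..}. emeasure M {x \<in> space M. t \<le> V x} \<partial>lborel)"
proof -
  interpret pair_sigma_finite lborel M using assms(1)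
    by (simp add: pair_sigma_finite_def sigma_finite_lborel)
  have "(\<integral>\<^sup>+x. ennreal (V x) \<partial>M)
      = (\<integral>\<^sup>+x. (\<integral>\<^sup>+t. indicator {0..} t * indicator {x \<in> space M. t \<le> V x} x \<partial>lborel) \<partial>M)"
  proof (intro nn_integral_cong)
    fix x assume "x \<in> space M"
    then have "(\<integral>\<^sup>+t. indicator {0..} t * indicator {x \<in> space M. t \<le> V x} x \<partial>lborel)
        = (\<integral>\<^sup>+t. indicator {0..V x} t \<partial>lborel)"
      by (intro nn_integral_cong) (auto simp: indicator_def)
    then show "ennreal (V x) = (\<integral>\<^sup>+t. indicator {0..} t * indicator {x \<in> space M. t \<le> V x} x \<partial>lborel)"
      by (cases "0 \<le> V x") (auto simp: ennreal_neg)
  qed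
  also have "\<dots> = (\<integral>\<^sup>+t. (\<integral>\<^sup>+x. indicator {0..} t * indicator {x \<in> space M. t \<le> V x} x \<partial>M) \<partial>lborel)"
    by (rule Fubini') measurable
  also have "\<dots> = (\<integral>\<^sup>+t\<in>{0..}. emeasure M {x \<in> space M. t \<le> V x} \<partial>lborel)"
    by (intro nn_integral_cong) (simp add: nn_integral_cmult mult.commute)
  finally show ?thesis .
qed

text \<open>All \<open>n\<close> winners pay the same price, whose expectation the layer cake
  formula expresses through its tails. The assumption \<open>n < N\<close> keeps rank
  \<open>n + 1\<close> away from the default value 0.\<close>

lemma RevVCG_eq:
  assumes "prob_space F" and [measurable_cong]: "sets F = sets borel" and "n < N"
  shows "RevVCG n N F =
    of_nat n * (\<integral>\<^sup>+t\<in>{0..}. ennreal (binomial_tail N (Suc n) (measure F {t..})) \<partial>lborel)"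
proof -
  let ?M = "Pi\<^sub>M {..<N} (\<lambda>_. F)"
  interpret P: prob_space ?M by (intro prob_space_PiM assms(1))
  let ?V = "\<lambda>v. kth_highest N v (Suc n)"
  have ge: "{v \<in> space ?M. t \<le> ?V v} = {v \<in> space ?M. Suc n \<le> card {i. i < N \<and> t \<le> v i}}" for t
    using assms(3) by (simp add: kth_highest_ge_iff)
  have [measurable]: "?V \<in> borel_measurable ?M"
    unfolding borel_measurable_iff_ge ge by measurable
  have "RevVCG n N F = (\<integral>\<^sup>+v. of_nat n * ennreal (?V v) \<partial>?M)"
    by (simp add: RevVCG_def vcg_payment_def ennreal_mult' ennreal_of_nat_eq_real_of_nat)
  also have "\<dots> = of_nat n * (\<integral>\<^sup>+v. ennreal (?V v) \<partial>?M)"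
    by (intro nn_integral_cmult) measurable
  also have "(\<integral>\<^sup>+v. ennreal (?V v) \<partial>?M) = (\<integral>\<^sup>+t\<in>{0..}. emeasure ?M {v \<in> space ?M. t \<le> ?V v} \<partial>lborel)"
    by (intro nn_integral_layer_cake P.sigma_finite_measure) measurable
  finally show ?thesis
    unfolding ge emeasure_PiM_count_ge[OF assms(1,2)] .
qed

text \<open>The case of no extra buyers, where the price is the default value 0.\<close>

lemma RevVCG_balanced: "RevVCG n n F = 0"
  by (simp add: RevVCG_def vcg_payment_def kth_highest_def)

lemma RevOPT_eq:
  assumes "prob_space F" and [measurable_cong]: "sets F = sets borel" and "0 \<le> monopoly_reserve F"
  shows "RevOPT n n F = of_nat n * ennreal (monopoly_reserve F * measure F {monopoly_reserve F..})"
proof -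
  let ?M = "Pi\<^sub>M {..<n} (\<lambda>_. F)" and ?r = "monopoly_reserve F"
  interpret F: prob_space F by fact
  interpret finite_product_prob_space "\<lambda>_::nat. F" "{..<n}" by unfold_locales auto
  have "RevOPT n n F = (\<integral>\<^sup>+v. ennreal ?r * (\<Sum>i<n. indicator {?r..} (v i)) \<partial>?M)"
    unfolding RevOPT_def
  proof (intro nn_integral_cong)
    fix v :: "nat \<Rightarrow> real"
    have "real (card {i. i < n \<and> ?r \<le> v i}) = (\<Sum>i<n. indicator {?r..} (v i))"
      by (simp add: indicator_def sum.If_cases Int_def)
    then have "ennreal (card {i. i < n \<and> ?r \<le> v i}) = (\<Sum>i<n. indicator {?r..} (v i))"
      by (simp add: ennreal_indicator flip: sum_ennreal)
    then show "ennreal (reserve_payment ?r n n v) = ennreal ?r * (\<Sum>i<n. indicator {?r..} (v i))"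
      using assms(3) by (simp add: reserve_payment_balanced ennreal_mult)
  qed
  also have "\<dots> = ennreal ?r * (\<Sum>i<n. \<integral>\<^sup>+v. indicator {?r..} (v i) \<partial>?M)"
    by (subst nn_integral_cmult) (measurable, simp add: nn_integral_sum)
  also have "(\<Sum>i<n. \<integral>\<^sup>+v. indicator {?r..} (v i) \<partial>?M) = (\<Sum>i<n. ennreal (measure F {?r..}))"
  proof (intro sum.cong refl)
    fix i assume i: "i \<in> {..<n}"
    have "(\<integral>\<^sup>+v. indicator {?r..} (v i) \<partial>?M) = (\<integral>\<^sup>+x. indicator {?r..} x \<partial>distr ?M F (\<lambda>v. v i))"
      using i by (subst nn_integral_distr) auto
    also have "distr ?M F (\<lambda>v. v i) = F"
      using i assms(1) by (intro distr_PiM_component) auto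
    finally show "(\<integral>\<^sup>+v. indicator {?r..} (v i) \<partial>?M) = ennreal (measure F {?r..})"
      by (simp add: assms(2) F.emeasure_eq_measure)
  qed
  finally show ?thesis
    using assms(3) by (simp add: ennreal_mult ennreal_of_nat_eq_real_of_nat ac_simps)
qed

subsection \<open>Binomial tails and the beta distribution\<close>

text \<open>The density of Beta(\<open>n + 1\<close>, \<open>k + 1\<close>): both parameters are shifted by one.\<close>

definition beta_dens :: "nat \<Rightarrow> nat \<Rightarrow> real \<Rightarrow> real" where
  "beta_dens n k u = real (n + Suc k) * real ((n + k) choose n) * u ^ n * (1 - u) ^ k"

text \<open>By the product rule and the two absorption identities for binomial coefficients, the
  derivative of the \<open>j\<close>-th summand is \<open>T (j - 1) - T j\<close>, so the sum
  telescopes.\<close>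

lemma binomial_tail_deriv:
  "(binomial_tail (n + Suc k) (Suc n) has_real_derivative beta_dens n k p) (at p)"
proof -
  let ?N = "n + Suc k" and ?M = "n + k"
  define T where "T j = real ?N * real (?M choose j) * p ^ j * (1 - p) ^ (?M - j)" for j
  have tel: "real (?N choose j) * real j * p ^ (j - 1) * (1 - p) ^ (?N - j)
      - real (?N choose j) * p ^ j * (real (?N - j) * (1 - p) ^ (?N - j - 1)) = T (j - 1) - T j"
    if "j \<in> {Suc n..?N}" for j
  proof -
    from that obtain i where j: "j = Suc i" by (cases j) auto
    have "real (?N choose j) * real j = real ?N * real (?M choose i)"
      using arg_cong[OF Suc_times_binomial_eq[of ?M i], of real] unfolding j
      by (simp only: of_nat_mult add_Suc_right mult.commute)
    moreover have "real (?N choose j) * real (?N - j) = real ?N * real (?M choose j)"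
      using arg_cong[OF binomial_absorb_comp[of ?N j], of real]
      by (simp only: of_nat_mult add_Suc_right diff_Suc_1 mult.commute)
    moreover have "?N - j = ?M - i" "?N - j - 1 = ?M - j" unfolding j by auto
    ultimately show ?thesis unfolding T_def j
      by (simp add: mult.assoc[symmetric])
  qed
  have "(binomial_tail ?N (Suc n) has_real_derivative
      (\<Sum>j=Suc n..?N. real (?N choose j) * real j * p ^ (j - 1) * (1 - p) ^ (?N - j)
      - real (?N choose j) * p ^ j * (real (?N - j) * (1 - p) ^ (?N - j - 1)))) (at p)"
    unfolding binomial_tail_def
    by (rule derivative_eq_intros refl | simp)+ (simp add: algebra_simps)
  also have "(\<Sum>j=Suc n..?N. real (?N choose j) * real j * p ^ (j - 1) * (1 - p) ^ (?N - j)
      - real (?N choose j) * p ^ j * (real (?N - j) * (1 - p) ^ (?N - j - 1)))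
      = (\<Sum>j=Suc n..?N. T (j - 1) - T j)"
    by (intro sum.cong tel refl)
  also have "\<dots> = (\<Sum>i=n..<?N. T i - T (Suc i))"
    by (rule sum.reindex_bij_witness[of _ Suc "\<lambda>j. j - 1"]) auto
  also have "\<dots> = T n - T ?N" using sum_Suc_diff'[of n ?N "\<lambda>i. - T i"] by simp
  \<comment> \<open>\<open>T ?N\<close> vanishes because its binomial coefficient does.\<close>
  also have "\<dots> = beta_dens n k p" by (simp add: T_def beta_dens_def)
  finally show ?thesis .
qed

lemma binomial_tail_0: "binomial_tail N (Suc n) 0 = 0"
  by (simp add: binomial_tail_def)

lemma binomial_tail_1: "Suc n \<le> N \<Longrightarrow> binomial_tail N (Suc n) 1 = 1"
proof -
  assume N: "Suc n \<le> N"
  have "binomial_tail N (Suc n) 1 = (\<Sum>j=Suc n..N. if j = N then 1 else 0)"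
    unfolding binomial_tail_def by (intro sum.cong) auto
  then show ?thesis using N by simp
qed

lemma beta_dens_nonneg: "0 \<le> u \<Longrightarrow> u \<le> 1 \<Longrightarrow> 0 \<le> beta_dens n k u"
  by (simp add: beta_dens_def)

lemma beta_dens_measurable [measurable]: "beta_dens n k \<in> borel_measurable borel"
  unfolding beta_dens_def by measurable

lemma binomial_tail_mono:
  "0 \<le> p \<Longrightarrow> p \<le> q \<Longrightarrow> q \<le> 1 \<Longrightarrow> binomial_tail (n + Suc k) (Suc n) p \<le> binomial_tail (n + Suc k) (Suc n) q"
  by (rule DERIV_nonneg_imp_nondecreasing[of p q "binomial_tail (n + Suc k) (Suc n)"])
     (use binomial_tail_deriv beta_dens_nonneg in \<open>meson order_trans\<close>)+

lemma nn_integral_beta_dens: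
  assumes "0 \<le> s" "s \<le> 1"
  shows "(\<integral>\<^sup>+u\<in>{0..s}. beta_dens n k u \<partial>lborel) = ennreal (binomial_tail (n + Suc k) (Suc n) s)"
  using assms
  by (subst nn_integral_FTC_Icc[where F = "binomial_tail (n + Suc k) (Suc n)"])
     (auto intro: binomial_tail_deriv beta_dens_nonneg simp: binomial_tail_0 simp del: add_Suc_right)

text \<open>The law of Beta(\<open>n + 1\<close>, \<open>k + 1\<close>), which belongs to a market
  with \<open>Suc k\<close> extra buyers.\<close>

definition beta_measure :: "nat \<Rightarrow> nat \<Rightarrow> real measure" where
  "beta_measure n k = density lborel (\<lambda>u. ennreal (beta_dens n k u * indicator {0..1} u))"

lemma sets_beta_measure [measurable_cong, simp]: "sets (beta_measure n k) = sets borel"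
  by (simp add: beta_measure_def)

lemma emeasure_beta_measure:
  assumes "0 \<le> s" "s \<le> 1"
  shows "emeasure (beta_measure n k) {..s} = ennreal (binomial_tail (n + Suc k) (Suc n) s)"
proof -
  have "emeasure (beta_measure n k) {..s}
      = (\<integral>\<^sup>+u. ennreal (beta_dens n k u * indicator {0..1} u) * indicator {..s} u \<partial>lborel)"
    unfolding beta_measure_def by (subst emeasure_density) auto
  also have "\<dots> = (\<integral>\<^sup>+u\<in>{0..s}. beta_dens n k u \<partial>lborel)"
    using assms by (intro nn_integral_cong) (auto simp: indicator_def)
  finally show ?thesis using nn_integral_beta_dens[OF assms] by simp
qed

lemma AE_beta_measure: "AE u in beta_measure n k. 0 < u \<and> u < 1"
proof -
  have "AE u in lborel. u \<noteq> (0::real)" "AE u in lborel. u \<noteq> (1::real)"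
    by (rule AE_lborel_singleton)+
  then have "AE u in lborel. 0 < ennreal (beta_dens n k u * indicator {0..1} u) \<longrightarrow> 0 < u \<and> u < 1"
    by eventually_elim (auto simp: indicator_def split: if_splits)
  then show ?thesis unfolding beta_measure_def by (subst AE_density) auto
qed

lemma prob_space_beta_measure: "prob_space (beta_measure n k)"
proof
  have "space (beta_measure n k) = UNIV" by (simp add: beta_measure_def)
  then have "emeasure (beta_measure n k) (space (beta_measure n k)) = emeasure (beta_measure n k) {..1}"
    using AE_beta_measure[of n k] by (intro emeasure_eq_AE) (auto elim!: eventually_mono simp del: AE_conj_iff)
  then show "emeasure (beta_measure n k) (space (beta_measure n k)) = 1"
    by (simp add: emeasure_beta_measure binomial_tail_1)
qed

section \<open>Moments of the beta law\<close>

lemma has_bochner_integral_beta_dens: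
  "has_bochner_integral lborel (\<lambda>u. beta_dens n k u * indicator {0..1} u) 1"
  using has_bochner_integral_FTC_Icc_nonneg[of "beta_dens n k" 0 1 "binomial_tail (n + Suc k) (Suc n)"]
  by (auto simp: binomial_tail_deriv beta_dens_nonneg binomial_tail_0 binomial_tail_1 simp del: add_Suc_right)

text \<open>If multiplying by \<open>g\<close> turns the density into \<open>c\<close> times another
  beta density, then \<open>c\<close> is the expectation of \<open>g\<close>, since the other
  density has total mass 1. All moments below are obtained this way.\<close>

lemma has_bochner_integral_beta_measure:
  assumes [measurable]: "g \<in> borel_measurable borel"
    and "\<And>u. 0 < u \<Longrightarrow> u < 1 \<Longrightarrow> beta_dens n k u * g u = c * beta_dens n' k' u"
  shows "has_bochner_integral (beta_measure n k) g c"
proof -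
  have "has_bochner_integral lborel (\<lambda>u. c * (beta_dens n' k' u * indicator {0..1} u)) (c * 1)"
    by (intro has_bochner_integral_mult_right has_bochner_integral_beta_dens)
  moreover have "AE u in lborel. c * (beta_dens n' k' u * indicator {0..1} u) = (beta_dens n k u * indicator {0..1} u) *\<^sub>R g u"
  proof -
    have "AE u in lborel. u \<noteq> (0::real)" "AE u in lborel. u \<noteq> (1::real)"
      by (rule AE_lborel_singleton)+
    then show ?thesis
      by eventually_elim (use assms(2) in \<open>auto simp: indicator_def\<close>)
  qed
  ultimately have "has_bochner_integral lborel (\<lambda>u. (beta_dens n k u * indicator {0..1} u) *\<^sub>R g u) c"
    by (subst has_bochner_integral_cong_AE[symmetric]) auto
  then show ?thesis
    unfolding beta_measure_def
    by (intro has_bochner_integral_density) (auto intro!: beta_dens_nonneg AE_I2 simp: indicator_def)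
qed

lemma beta_dens_rec:
  shows beta_dens_Suc_left: "u * beta_dens n k u = real (n + 1) / real (n + k + 2) * beta_dens (Suc n) k u"
    and beta_dens_Suc_right: "(1 - u) * beta_dens n k u = real (k + 1) / real (n + k + 2) * beta_dens n (Suc k) u"
proof -
  have "real (Suc (n + k)) * real (n + k choose n) = real (Suc (n + k) choose Suc n) * real (Suc n)"
    using Suc_times_binomial_eq[of "n + k" n] by (metis of_nat_mult)
  then show "u * beta_dens n k u = real (n + 1) / real (n + k + 2) * beta_dens (Suc n) k u"
    unfolding beta_dens_def by (simp add: divide_simps del: binomial_Suc_Suc)
  have "real (Suc (n + k)) * real (n + k choose n) = real (Suc (n + k) choose n) * real (Suc k)"
    using binomial_absorb_comp[of "Suc (n + k)" n] by (metis of_nat_mult mult.commute diff_Suc_1 Suc_diff_le le_add1 add_diff_cancel_left')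
  then show "(1 - u) * beta_dens n k u = real (k + 1) / real (n + k + 2) * beta_dens n (Suc k) u"
    unfolding beta_dens_def by (simp add: divide_simps del: binomial_Suc_Suc)
qed

lemma beta_measure_id: "has_bochner_integral (beta_measure n k) (\<lambda>u. u) (real (n + 1) / real (n + k + 2))"
  by (rule has_bochner_integral_beta_measure[of _ _ _ _ "Suc n" k])
     (simp, metis beta_dens_Suc_left mult.commute)

lemma beta_measure_square: "has_bochner_integral (beta_measure n k) (\<lambda>u. u ^ 2)
   (real (n + 1) * real (n + 2) / (real (n + k + 2) * real (n + k + 3)))"
proof (rule has_bochner_integral_beta_measure[of _ _ _ _ "Suc (Suc n)" k])
  fix u :: real
  have "beta_dens n k u * u\<^sup>2 = u * (u * beta_dens n k u)" by (simp add: power2_eq_square)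
  also have "\<dots> = real (n + 1) / real (n + k + 2) * (u * beta_dens (Suc n) k u)"
    by (subst beta_dens_Suc_left) (rule mult.left_commute)
  also have "\<dots> = real (n + 1) * real (n + 2) / (real (n + k + 2) * real (n + k + 3)) * beta_dens (Suc (Suc n)) k u"
    by (simp add: beta_dens_Suc_left add_ac)
  finally show "beta_dens n k u * u\<^sup>2 = real (n + 1) * real (n + 2) / (real (n + k + 2) * real (n + k + 3)) * beta_dens (Suc (Suc n)) k u" .
qed measurable

text \<open>Here the recursion is read backwards: dividing by \<open>u\<close> lowers the first
  index, which therefore has to be a successor.\<close>

lemma beta_measure_inverse: "has_bochner_integral (beta_measure (Suc n) k) (\<lambda>u. 1 / u) (real (n + k + 2) / real (n + 1))"
proof (rule has_bochner_integral_beta_measure[of _ _ _ _ n k])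
  fix u :: real assume "0 < u"
  then show "beta_dens (Suc n) k u * (1 / u) = real (n + k + 2) / real (n + 1) * beta_dens n k u"
    using beta_dens_Suc_left[of u n k] by (simp add: field_simps)
qed measurable

lemma beta_measure_inverse_compl:
  "has_bochner_integral (beta_measure n (Suc k)) (\<lambda>u. 1 / (1 - u)) (real (n + k + 2) / real (k + 1))"
proof (rule has_bochner_integral_beta_measure[of _ _ _ _ n k])
  fix u :: real assume "u < 1"
  then show "beta_dens n (Suc k) u * (1 / (1 - u)) = real (n + k + 2) / real (k + 1) * beta_dens n k u"
    using beta_dens_Suc_right[of u n k] by (simp add: divide_simps del: distrib_left_numeral distrib_right_numeral) (simp add: mult_ac)
qed measurable

text \<open>The integrand is the probability that \<open>U\<close> is at most
  \<open>exp (- (l * t))\<close>, that is, that \<open>t\<close> is at most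
  \<open>- ln U / l\<close>. After Tonelli the inner integral is the length of an interval of such
  \<open>t\<close>.\<close>

lemma nn_integral_binomial_tail_exp:
  assumes "0 < l"
  shows "(\<integral>\<^sup>+t\<in>{0..}. ennreal (binomial_tail (n + Suc k) (Suc n) (exp (- (l * t)))) \<partial>lborel)
     = (\<integral>\<^sup>+u. ennreal (- ln u / l) \<partial>beta_measure n k)"
    and "(\<integral>\<^sup>+t\<in>{0..r}. ennreal (binomial_tail (n + Suc k) (Suc n) (exp (- (l * t)))) \<partial>lborel)
     = (\<integral>\<^sup>+u. ennreal (min r (- ln u / l)) \<partial>beta_measure n k)"
proof -
  interpret B: prob_space "beta_measure n k" by (rule prob_space_beta_measure)
  interpret pair_sigma_finite lborel "beta_measure n k"
    by (simp add: pair_sigma_finite_def sigma_finite_lborel B.sigma_finite_measure)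
  have *: "(\<integral>\<^sup>+t. indicator A t * ennreal (binomial_tail (n + Suc k) (Suc n) (exp (- (l * t)))) \<partial>lborel)
     = (\<integral>\<^sup>+u. (\<integral>\<^sup>+t. indicator A t * indicator {..exp (- (l * t))} u \<partial>lborel) \<partial>beta_measure n k)"
    if [measurable]: "A \<in> sets borel" and "A \<subseteq> {0..}" for A
  proof -
    have "(\<integral>\<^sup>+t. indicator A t * ennreal (binomial_tail (n + Suc k) (Suc n) (exp (- (l * t)))) \<partial>lborel)
      = (\<integral>\<^sup>+t. (\<integral>\<^sup>+u. indicator A t * indicator {..exp (- (l * t))} u \<partial>beta_measure n k) \<partial>lborel)"
    proof (intro nn_integral_cong)
      fix t
      show "indicator A t * ennreal (binomial_tail (n + Suc k) (Suc n) (exp (- (l * t))))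
        = (\<integral>\<^sup>+u. indicator A t * indicator {..exp (- (l * t))} u \<partial>beta_measure n k)"
        using that(2) assms
        by (cases "t \<in> A") (auto simp: nn_integral_cmult emeasure_beta_measure)
    qed
    also have "\<dots> = (\<integral>\<^sup>+u. (\<integral>\<^sup>+t. indicator A t * indicator {..exp (- (l * t))} u \<partial>lborel) \<partial>beta_measure n k)"
    proof (rule Fubini'[symmetric])
      have "(\<lambda>(t, u). indicator A t * indicator {x. snd x \<le> exp (- (l * fst x))} (t, u) :: ennreal)
        \<in> borel_measurable (lborel \<Otimes>\<^sub>M beta_measure n k)"
        by measurable
      then show "(\<lambda>(t, u). indicator A t * indicator {..exp (- (l * t))} u :: ennreal)
        \<in> borel_measurable (lborel \<Otimes>\<^sub>M beta_measure n k)"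
        \<comment> \<open>The indicator is first written with a fixed measurable set of pairs, since
          the set \<open>{..exp (- (l * t))}\<close> itself varies with \<open>t\<close>.\<close>
        by (rule measurable_cong[THEN iffD1, rotated]) (auto simp: indicator_def)
    qed
    finally show ?thesis .
  qed
  have iff: "u \<le> exp (- (l * t)) \<longleftrightarrow> t \<le> - ln u / l" if "0 < u" for u t
  proof -
    have "u \<le> exp (- (l * t)) \<longleftrightarrow> ln u \<le> - (l * t)"
      using that by (metis exp_le_cancel_iff exp_ln)
    then show ?thesis using assms by (auto simp: field_simps)
  qed
  have "(\<integral>\<^sup>+t. indicator {0..} t * ennreal (binomial_tail (n + Suc k) (Suc n) (exp (- (l * t)))) \<partial>lborel)
     = (\<integral>\<^sup>+u. ennreal (- ln u / l) \<partial>beta_measure n k)"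
  proof (subst *; (intro nn_integral_cong_AE)?)
    show "AE u in beta_measure n k. (\<integral>\<^sup>+t. indicator {0..} t * indicator {..exp (- (l * t))} u \<partial>lborel) = ennreal (- ln u / l)"
      using AE_beta_measure
    proof eventually_elim
      case (elim u)
      have "(\<integral>\<^sup>+t. indicator {0..} t * indicator {..exp (- (l * t))} u \<partial>lborel) = (\<integral>\<^sup>+t. indicator {0..- ln u / l} t \<partial>lborel)"
        using elim by (intro nn_integral_cong) (auto simp: indicator_def iff)
      moreover have "0 \<le> - ln u / l" using elim assms by (intro divide_nonneg_pos) auto
      ultimately show ?case by simp
    qed
  qed auto
  then show "(\<integral>\<^sup>+t\<in>{0..}. ennreal (binomial_tail (n + Suc k) (Suc n) (exp (- (l * t)))) \<partial>lborel)
     = (\<integral>\<^sup>+u. ennreal (- ln u / l) \<partial>beta_measure n k)"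
    by (simp add: mult.commute)
  have "(\<integral>\<^sup>+t. indicator {0..r} t * ennreal (binomial_tail (n + Suc k) (Suc n) (exp (- (l * t)))) \<partial>lborel)
     = (\<integral>\<^sup>+u. ennreal (min r (- ln u / l)) \<partial>beta_measure n k)"
  proof (subst *; (intro nn_integral_cong_AE)?)
    show "AE u in beta_measure n k. (\<integral>\<^sup>+t. indicator {0..r} t * indicator {..exp (- (l * t))} u \<partial>lborel) = ennreal (min r (- ln u / l))"
      using AE_beta_measure
    proof eventually_elim
      case (elim u)
      have "(\<integral>\<^sup>+t. indicator {0..r} t * indicator {..exp (- (l * t))} u \<partial>lborel) = (\<integral>\<^sup>+t. indicator {0..min r (- ln u / l)} t \<partial>lborel)"
        using elim by (intro nn_integral_cong) (auto simp: indicator_def iff)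
      moreover have "0 \<le> - ln u / l" using elim assms by (intro divide_nonneg_pos) auto
      ultimately show ?case
        by (cases "0 \<le> r") (auto simp: ennreal_neg min_def)
    qed
  qed auto
  then show "(\<integral>\<^sup>+t\<in>{0..r}. ennreal (binomial_tail (n + Suc k) (Suc n) (exp (- (l * t)))) \<partial>lborel)
     = (\<integral>\<^sup>+u. ennreal (min r (- ln u / l)) \<partial>beta_measure n k)"
    by (simp add: mult.commute)
qed

subsection \<open>The truncated logarithm of a beta variable\<close>

text \<open>The difference of the two sides vanishes at 1, and its derivative is
  \<open>(x - 1)\<^sup>2 / (x * (x + 1)\<^sup>2)\<close>. This is sharper than the tangent at 1 and
  still has a reciprocal whose beta expectation is explicit.\<close>

lemma ln_le_pade:
  fixes u :: real
  assumes "0 < u" "u \<le> 1"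
  shows "ln u \<le> 2 * (u - 1) / (u + 1)"
proof -
  let ?g = "\<lambda>u::real. ln u - 2 * (u - 1) / (u + 1)"
  have "?g u \<le> ?g 1"
  proof (rule DERIV_nonneg_imp_nondecreasing[OF assms(2)])
    fix x :: real assume x: "u \<le> x"
    have "(?g has_real_derivative 1 / x - (2 * (x + 1) - 2 * (x - 1)) / (x + 1)\<^sup>2) (at x)"
      using x assms by (auto intro!: derivative_eq_intros simp: power2_eq_square)
    moreover have "1 / x - (2 * (x + 1) - 2 * (x - 1)) / (x + 1)\<^sup>2 = (x - 1)\<^sup>2 / (x * (x + 1)\<^sup>2)"
      using x assms by (simp add: divide_simps) (simp add: power2_eq_square algebra_simps)
    ultimately show "\<exists>y. (?g has_real_derivative y) (at x) \<and> 0 \<le> y"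
      using x assms by (metis (no_types, lifting) divide_nonneg_nonneg mult_nonneg_nonneg order.strict_trans1 less_imp_le order_trans zero_le_power2)
  qed
  then show ?thesis by simp
qed

lemma exp_ge_Taylor:
  fixes x :: real
  assumes "0 \<le> x \<or> even n"
  shows "(\<Sum>m<n. x ^ m / fact m) \<le> exp x"
proof -
  obtain t where "exp x = (\<Sum>m<n. x ^ m / fact m) + exp t / fact n * x ^ n"
    using Maclaurin_exp_le by blast
  moreover have "0 \<le> exp t / fact n * x ^ n"
    using assms by (auto intro!: mult_nonneg_nonneg zero_le_even_power)
  ultimately show ?thesis by simp
qed

text \<open>The slope \<open>57/80\<close> is \<open>(1/2 + 235/100) / 4\<close>, the largest value
  of \<open>M / 4\<close> in \<open>expectation_min_ln_ge_small\<close>. The proof replaces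
  \<open>exp a\<close> by its cubic Taylor polynomial.\<close>

lemma exp_neg_le_chord:
  fixes a :: real
  assumes "0 \<le> a" "a \<le> 7/10"
  shows "exp (- a) \<le> 1 - 57/80 * a"
proof -
  have "1 + a + a\<^sup>2 / 2 + a ^ 3 / 6 \<le> exp a"
    using exp_ge_Taylor[of a 4] assms(1) by (simp add: eval_nat_numeral)
  moreover have "0 < 1 - 57/80 * a" using assms by simp
  ultimately have "(1 + a + a\<^sup>2 / 2 + a ^ 3 / 6) * (1 - 57/80 * a) \<le> exp a * (1 - 57/80 * a)"
    by (intro mult_right_mono) auto
  moreover have "1 \<le> (1 + a + a\<^sup>2 / 2 + a ^ 3 / 6) * (1 - 57/80 * a)"
  proof -
    have "a\<^sup>2 \<le> (7/10)\<^sup>2" "a ^ 3 \<le> (7/10) ^ 3" using assms by (intro power_mono; simp)+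
    \<comment> \<open>This polynomial decreases in \<open>a\<close> and is still positive at
      \<open>7/10\<close>.\<close>
    then have "0 \<le> 23/80 - 17/80 * a - 91/480 * a\<^sup>2 - 19/160 * a ^ 3"
      using assms by (simp add: power2_eq_square power3_eq_cube)
    then have "0 \<le> a * (23/80 - 17/80 * a - 91/480 * a\<^sup>2 - 19/160 * a ^ 3)"
      using assms(1) by (rule mult_nonneg_nonneg[rotated])
    moreover have "(1 + a + a\<^sup>2 / 2 + a ^ 3 / 6) * (1 - 57/80 * a)
      = 1 + a * (23/80 - 17/80 * a - 91/480 * a\<^sup>2 - 19/160 * a ^ 3)"
      by (simp add: field_simps power2_eq_square power3_eq_cube)
    ultimately show ?thesis by linarith
  qed
  ultimately have "1 \<le> exp a * (1 - 57/80 * a)" by linarith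
  then show ?thesis by (simp add: exp_minus divide_simps mult.commute)
qed

section \<open>Numerical bounds around \<open>1 / exp 1\<close> and
  \<open>exp (1 / exp 1)\<close>\<close>

lemma exp_one_inverse_bounds: "1 / exp 1 \<ge> (367/1000 :: real)" "1 / exp 1 \<le> (37/100 :: real)"
proof -
  show "1 / exp 1 \<ge> (367/1000 :: real)" using e_less_272 by (simp add: field_simps)
  have "100 / 37 \<le> exp (1::real)"
    using exp_ge_Taylor[of 1 6] by (simp add: eval_nat_numeral)
  then show "1 / exp 1 \<le> (37/100 :: real)" by (simp add: field_simps)
qed

lemma exp_exp_bounds:
  shows "144/100 \<le> exp (1 / exp 1 :: real)" "exp (1 / exp 1 :: real) \<le> 145/100"
proof -
  have "144/100 \<le> exp (367/1000 :: real)"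
    using exp_ge_Taylor[of "367/1000" 4] by (simp add: eval_nat_numeral)
  also have "\<dots> \<le> exp (1 / exp 1)" using exp_one_inverse_bounds by simp
  finally show "144/100 \<le> exp (1 / exp 1 :: real)" .
  have even: "even (6 :: nat)" by simp
  \<comment> \<open>A lower bound at a negative argument, valid for an even number of Taylor terms,
    inverts to an upper bound for \<open>exp (37/100)\<close>.\<close>
  have "100/145 \<le> exp (-37/100 :: real)"
    using exp_ge_Taylor[OF disjI2[OF even], of "-37/100"] by (simp add: eval_nat_numeral)
  then have "exp (37/100) \<le> (145/100 :: real)" by (simp add: exp_minus field_simps)
  moreover have "exp (1 / exp 1) \<le> exp (37/100 :: real)" using exp_one_inverse_bounds by simp
  ultimately show "exp (1 / exp 1 :: real) \<le> 145/100" by linarith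
qed

lemma mult_exp_minus_le: "(a::real) * exp (- a) \<le> 1 / exp 1"
proof -
  have "a \<le> exp (a - 1)" using exp_ge_add_one_self[of "a - 1"] by simp
  then have "a * exp (- a) \<le> exp (a - 1) * exp (- a)" by (intro mult_right_mono) auto
  also have "\<dots> = 1 / exp 1" by (simp add: exp_diff exp_minus)
  finally show ?thesis .
qed

text \<open>With \<open>x = - ln u\<close>, the expression \<open>a - a\<^sup>2 / (4 * x)\<close> is
  at most \<open>a\<close>, and it is at most \<open>x\<close> because the difference is
  \<open>(x - a / 2)\<^sup>2 / x\<close>. The bound \<open>ln_le_pade\<close> then replaces
  \<open>1 / x\<close> by \<open>1 / (1 - u) - 1 / 2\<close>.\<close>

lemma min_ln_ge_inverse:
  fixes a u :: real
  assumes "0 < u" "u < 1" "0 < a"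
  shows "a - a\<^sup>2 / 4 * (1 / (1 - u) - 1 / 2) \<le> min a (- ln u)"
proof -
  define x where "x = - ln u"
  have x: "2 * (1 - u) / (1 + u) \<le> x"
    using ln_le_pade[of u] assms unfolding x_def by (simp add: field_simps)
  moreover have "0 < 2 * (1 - u) / (1 + u)" using assms by simp
  ultimately have "0 < x" by linarith
  have "1 / x \<le> 1 / (2 * (1 - u) / (1 + u))"
    using x \<open>0 < 2 * (1 - u) / (1 + u)\<close> by (intro divide_left_mono mult_pos_pos \<open>0 < x\<close>) auto
  also have "\<dots> = 1 / (1 - u) - 1 / 2" using assms by (simp add: divide_simps)
  finally have "a\<^sup>2 / 4 * (1 / x) \<le> a\<^sup>2 / 4 * (1 / (1 - u) - 1 / 2)" by (intro mult_left_mono) auto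
  moreover have "a - a\<^sup>2 / 4 * (1 / x) \<le> x"
  proof -
    have "x - (a - a\<^sup>2 / 4 * (1 / x)) = (x - a / 2)\<^sup>2 / x"
      using \<open>0 < x\<close> by (simp add: field_simps power2_eq_square)
    also have "\<dots> \<ge> 0" using \<open>0 < x\<close> by simp
    finally show ?thesis by simp
  qed
  moreover have "a - a\<^sup>2 / 4 * (1 / x) \<le> a" using \<open>0 < x\<close> by simp
  ultimately show ?thesis unfolding x_def by linarith
qed

lemma integrable_min_ln: "0 \<le> a \<Longrightarrow> integrable (beta_measure n k) (\<lambda>u. min a (- ln u))"
proof -
  assume a: "0 \<le> a"
  interpret B: prob_space "beta_measure n k" by (rule prob_space_beta_measure)
  show ?thesis
  proof (rule B.integrable_const_bound[where B = a])
    show "AE u in beta_measure n k. norm (min a (- ln u)) \<le> a"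
      using AE_beta_measure
    proof eventually_elim
      case (elim u)
      then have "ln u < 0" by simp
      then show ?case using a by auto
    qed
  qed simp
qed

lemma expectation_min_ln_ge_small:
  assumes a: "0 < a" "a \<le> 7/10" and nk: "real (n + 1) / real (k + 1) \<le> 235/100"
  shows "a * exp (- a) \<le> (\<integral>u. min a (- ln u) \<partial>beta_measure n (Suc k))"
proof -
  interpret B: prob_space "beta_measure n (Suc k)" by (rule prob_space_beta_measure)
  \<comment> \<open>The second index \<open>Suc k\<close> makes the expectation of
    \<open>1 / (1 - U)\<close> finite and explicit; \<open>M\<close> below is this expectation minus
    \<open>1 / 2\<close>.\<close>
  note I = beta_measure_inverse_compl[of n k, unfolded has_bochner_integral_iff]
  define M where "M = real (n + k + 2) / real (k + 1) - 1 / 2"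
  define q where "q = real (n + 1) / real (k + 1)"
  have "M = 1 / 2 + q" by (simp add: M_def q_def field_simps)
  then have "M / 4 \<le> 57/80" using nk[folded q_def] by linarith
  then have "a * (M / 4) \<le> a * (57/80)" using a by (intro mult_left_mono) simp_all
  then have "exp (- a) \<le> 1 - a * (M / 4)"
    using exp_neg_le_chord[of a] a by linarith
  then have "a * (exp (- a)) \<le> a * (1 - a * (M / 4))"
    using a by (intro mult_left_mono) auto
  also have "\<dots> = a - a\<^sup>2 / 4 * M" by (simp add: algebra_simps power2_eq_square)
  also have "\<dots> = (\<integral>u. a - a\<^sup>2 / 4 * (1 / (1 - u) - 1 / 2) \<partial>beta_measure n (Suc k))"
    using I by (simp add: B.prob_space M_def)
  also have "\<dots> \<le> (\<integral>u. min a (- ln u) \<partial>beta_measure n (Suc k))"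
  proof (rule integral_mono_AE)
    show "AE u in beta_measure n (Suc k). a - a\<^sup>2 / 4 * (1 / (1 - u) - 1 / 2) \<le> min a (- ln u)"
      using AE_beta_measure by eventually_elim (rule min_ln_ge_inverse, use a in simp_all)
    show "integrable (beta_measure n (Suc k)) (\<lambda>u. a - a\<^sup>2 / 4 * (1 / (1 - u) - 1 / 2))"
      using I by auto
  qed (use a in \<open>auto intro: integrable_min_ln\<close>)
  finally show ?thesis .
qed

text \<open>The linear part is the tangent of \<open>- ln u\<close> at
  \<open>u = exp (- 1 / e)\<close>. The coefficient \<open>25 / 33\<close> makes the maximum of
  \<open>y - 25 / 33 * y\<^sup>2\<close> equal to \<open>33 / 100\<close>, which is at most
  \<open>a - 1 / e\<close> because \<open>1 / e\<close> is at most \<open>37 / 100\<close>.\<close>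

lemma min_ln_ge_quadratic:
  fixes a u :: real
  assumes "0 < u" "7/10 \<le> a"
  defines "y \<equiv> 1 - exp (1 / exp 1) * u"
  shows "1 / exp 1 + y - 25 / 33 * y\<^sup>2 \<le> min a (- ln u)"
proof -
  have "ln (exp (1 / exp 1) * u) \<le> exp (1 / exp 1) * u - 1"
    using assms(1) by (intro ln_le_minus_one) simp
  then have "1 / exp 1 + y \<le> - ln u" using assms(1) by (simp add: ln_mult y_def)
  moreover have "0 \<le> 25 / 33 * y\<^sup>2" by simp
  moreover have "33 / 100 - (y - 25 / 33 * y\<^sup>2) = 25 / 33 * (y - 33 / 50)\<^sup>2"
    by (simp add: power2_eq_square algebra_simps)
  moreover have "0 \<le> 25 / 33 * (y - 33 / 50)\<^sup>2" by simp
  moreover have "1 / exp 1 \<le> a - 33 / 100" using exp_one_inverse_bounds(2) assms(2) by linarith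
  ultimately show ?thesis by linarith
qed

text \<open>The quadratic minorant is integrated using mean and variance of \<open>U\<close>. The
  slack \<open>6/10\<close> in \<open>lower\<close> makes the gain from the mean outweigh the loss
  from the variance. Here \<open>N\<close> is the sum of the beta parameters, one more than the
  number of bidders.\<close>

lemma expectation_min_ln_ge_large:
  fixes n k :: nat and a :: real
  defines "b \<equiv> exp (1 / exp 1 :: real)"
  defines "N \<equiv> real (n + k + 2)"
  assumes a: "7/10 \<le> a"
    and lower: "b * real (n + 1) + 6/10 \<le> N" and upper: "N \<le> 2 * real (n + 1)"
  shows "a * exp (- a) \<le> (\<integral>u. min a (- ln u) \<partial>beta_measure n k)"
proof -
  interpret B: prob_space "beta_measure n k" by (rule prob_space_beta_measure)
  note b = exp_exp_bounds[folded b_def]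
  note I = beta_measure_id[of n k, unfolded has_bochner_integral_iff]
    beta_measure_square[of n k, unfolded has_bochner_integral_iff]
  define x where "x = real (n + 1)"
  have N: "0 < N" by (simp add: N_def)
  \<comment> \<open>\<open>y\<close> is the mean of \<open>1 - b * U\<close> and \<open>V\<close> is
    the variance of \<open>U\<close>.\<close>
  define y where "y = 1 - b * (x / N)"
  define V where "V = x * (x + 1) / (N * (N + 1)) - (x / N)\<^sup>2"
  have "V = x * (N - x) / N\<^sup>2 / (N + 1)"
    using N by (simp add: V_def divide_simps) (simp add: power2_eq_square algebra_simps)
  also have "\<dots> \<le> (1 / 4) / (N + 1)"
  proof (intro divide_right_mono)
    have "0 \<le> (N - 2 * x)\<^sup>2" by simp
    then have "4 * (x * (N - x)) \<le> N\<^sup>2" by (simp add: power2_eq_square algebra_simps)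
    then show "x * (N - x) / N\<^sup>2 \<le> 1 / 4" using N by (simp add: divide_simps)
  qed (use N in auto)
  also have "\<dots> \<le> (1 / 4) / N" using N by (intro divide_left_mono) auto
  finally have V: "V \<le> (1 / 4) / N" .
  have "b\<^sup>2 \<le> (145 / 100)\<^sup>2" using b by (intro power_mono) auto
  then have "b\<^sup>2 * ((1 / 4) / N) \<le> (145 / 100)\<^sup>2 * ((1 / 4) / N)"
    using N by (intro mult_right_mono) auto
  moreover have "b\<^sup>2 * V \<le> b\<^sup>2 * ((1 / 4) / N)" using V by (intro mult_left_mono) auto
  ultimately have "b\<^sup>2 * V \<le> (145 / 100)\<^sup>2 * ((1 / 4) / N)" by linarith
  \<comment> \<open>Numerically, \<open>25 / 33 * (145 / 100)\<^sup>2 / 4\<close> is just below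
    \<open>4 / 10\<close>.\<close>
  then have bV: "25 / 33 * (b\<^sup>2 * V) \<le> (4 / 10) / N" using N by (simp add: field_simps power2_eq_square)
  have y1: "(6 / 10) / N \<le> y" using lower N by (simp add: y_def x_def divide_simps)
  have "1 / 2 \<le> x / N" using upper N by (simp add: x_def field_simps)
  then have "144 / 100 * (1 / 2) \<le> b * (x / N)" using b by (intro mult_mono) auto
  then have y2: "y \<le> 28 / 100" by (simp add: y_def)
  have "0 \<le> y" by (rule order_trans[OF _ y1]) (use N in simp)
  \<comment> \<open>Since \<open>y\<close> is at most \<open>28 / 100\<close>, the factor
    \<open>1 - 25 / 33 * y\<close> is at least \<open>78 / 100\<close>.\<close>
  then have "(6 / 10) / N * (78 / 100) \<le> y * (1 - 25 / 33 * y)"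
    using y1 y2 N by (intro mult_mono) auto
  moreover have "(4 / 10) / N \<le> (6 / 10) / N * (78 / 100)" using N by (simp add: field_simps)
  ultimately have key: "0 \<le> y - 25 / 33 * (y\<^sup>2 + b\<^sup>2 * V)"
    using bV by (simp add: power2_eq_square algebra_simps)
  have "a * exp (- a) \<le> 1 / exp 1" by (rule mult_exp_minus_le)
  also have "\<dots> \<le> 1 / exp 1 + (y - 25 / 33 * (y\<^sup>2 + b\<^sup>2 * V))" using key by simp
  also have "\<dots> = (\<integral>u. 1 / exp 1 + (1 - b * u) - 25 / 33 * (1 - 2 * b * u + b\<^sup>2 * u\<^sup>2) \<partial>beta_measure n k)"
  proof -
    have "real (n + 1) / real (n + k + 2) = x / N"
      and "real (n + 1) * real (n + 2) / (real (n + k + 2) * real (n + k + 3)) = V + (x / N)\<^sup>2"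
      by (simp_all add: x_def N_def V_def add_ac)
    with I have J: "(\<integral>u. u \<partial>beta_measure n k) = x / N" "integrable (beta_measure n k) (\<lambda>u. u)"
      "(\<integral>u. u\<^sup>2 \<partial>beta_measure n k) = V + (x / N)\<^sup>2" "integrable (beta_measure n k) (\<lambda>u. u\<^sup>2)"
      by simp_all
    show ?thesis using J by (simp add: B.prob_space y_def) (simp add: power2_eq_square algebra_simps)
  qed
  also have "\<dots> \<le> (\<integral>u. min a (- ln u) \<partial>beta_measure n k)"
  proof (rule integral_mono_AE)
    have *: "1 / exp 1 + (1 - b * u) - 25 / 33 * (1 - 2 * b * u + b\<^sup>2 * u\<^sup>2) \<le> min a (- ln u)" if "0 < u" for u
      using min_ln_ge_quadratic[OF that a] unfolding b_def[symmetric]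
      by (simp add: power2_eq_square algebra_simps)
    show "AE u in beta_measure n k. 1 / exp 1 + (1 - b * u) - 25 / 33 * (1 - 2 * b * u + b\<^sup>2 * u\<^sup>2) \<le> min a (- ln u)"
      using AE_beta_measure by eventually_elim (use * in blast)
  qed (use I a in \<open>auto intro!: integrable_min_ln\<close>)
  finally show ?thesis .
qed

text \<open>Jensen's inequality for \<open>ln (1 / U)\<close>, by integrating the tangent line of
  \<open>ln\<close> at the mean \<open>c\<close> of \<open>1 / U\<close>.\<close>

lemma nn_integral_ln_beta_measure_le:
  "(\<integral>\<^sup>+u. ennreal (- ln u) \<partial>beta_measure (Suc n) k) \<le> ennreal (ln (real (n + k + 2) / real (n + 1)))"
proof -
  interpret B: prob_space "beta_measure (Suc n) k" by (rule prob_space_beta_measure)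
  define c where "c = real (n + k + 2) / real (n + 1)"
  have c: "0 < c" by (simp add: c_def)
  have const: "has_bochner_integral (beta_measure (Suc n) k) (\<lambda>_. x) x" for x :: real
    by (simp add: has_bochner_integral_iff B.prob_space)
  have "has_bochner_integral (beta_measure (Suc n) k) (\<lambda>u. ln c + (1 / u / c - 1)) (ln c + (c / c - 1))"
    using beta_measure_inverse[of n k, folded c_def] c
    by (intro has_bochner_integral_add has_bochner_integral_diff has_bochner_integral_divide_zero const)
  then have h: "has_bochner_integral (beta_measure (Suc n) k) (\<lambda>u. ln c + (1 / u / c - 1)) (ln c)"
    using c by simp
  have le: "- ln u \<le> ln c + (1 / u / c - 1)" if "0 < u" for u
  proof -
    have "ln (1 / u / c) \<le> 1 / u / c - 1" using that c by (intro ln_le_minus_one) simp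
    then show ?thesis using that c by (simp add: ln_div ln_mult)
  qed
  have "(\<integral>\<^sup>+u. ennreal (- ln u) \<partial>beta_measure (Suc n) k) \<le> (\<integral>\<^sup>+u. ennreal (ln c + (1 / u / c - 1)) \<partial>beta_measure (Suc n) k)"
  proof (rule nn_integral_mono_AE)
    show "AE u in beta_measure (Suc n) k. ennreal (- ln u) \<le> ennreal (ln c + (1 / u / c - 1))"
      using AE_beta_measure by eventually_elim (intro ennreal_leI le, simp)
  qed
  also have "\<dots> = ennreal (ln c)"
  proof -
    have "AE u in beta_measure (Suc n) k. 0 \<le> ln c + (1 / u / c - 1)"
      using AE_beta_measure[of "Suc n" k]
    proof eventually_elim
      case (elim u)
      then have "0 \<le> - ln u" by simp
      with le[of u] elim show ?case by linarith
    qed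
    then show ?thesis using h by (subst nn_integral_eq_integral) (auto simp: has_bochner_integral_iff)
  qed
  finally show ?thesis unfolding c_def .
qed

subsection \<open>Survival functions of MHR distributions\<close>

text \<open>Every point outside the support has a null open neighbourhood, and by Lindelof countably
  many of them cover \<open>U\<close>.\<close>

lemma emeasure_open_disjoint_supp:
  assumes [measurable_cong]: "sets F = sets borel" and "open U" "U \<inter> supp F = {}"
  shows "emeasure F U = 0"
proof -
  let ?C = "{V. open V \<and> emeasure F V = 0}"
  obtain C where C: "C \<subseteq> ?C" "countable C" "\<Union>C = \<Union>?C"
    using Lindelof[of ?C] by auto
  have "U \<subseteq> \<Union>C"
    unfolding C(3)
  proof
    fix x assume "x \<in> U"
    then have "x \<notin> supp F" using assms(3) by auto
    then obtain V where "open V" "x \<in> V" "emeasure F V = 0"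
      by (auto simp: supp_def zero_less_iff_neq_zero)
    then show "x \<in> \<Union>?C" by blast
  qed
  moreover have "\<Union>C \<in> null_sets F"
    using null_sets_UN'[of C "\<lambda>V. V" F] C(1,2) by (fastforce simp: null_sets_def assms(1))
  ultimately have "U \<in> null_sets F"
    using assms(1,2) by (auto intro: null_sets_subset)
  then show ?thesis by auto
qed

lemma closed_supp: "closed (supp F)"
proof -
  have "- supp F = \<Union>{V. open V \<and> emeasure F V = 0}"
    by (auto simp: supp_def not_gr_zero)
  then have "open (- supp F)" by (auto intro: open_Union)
  then show ?thesis by (simp add: closed_def)
qed

text \<open>A discrete Gronwall argument: over each of \<open>m\<close> equal steps of length
  \<open>h\<close> the function keeps at least the fraction \<open>1 - L * h\<close>, and the
  product of these factors tends to the exponential.\<close>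

lemma exp_le_of_decrement_le:
  fixes S :: "real \<Rightarrow> real"
  assumes "x \<le> y" "0 \<le> S x" "0 \<le> L"
    and dec: "\<And>u v. x \<le> u \<Longrightarrow> u \<le> v \<Longrightarrow> v \<le> y \<Longrightarrow> S u - S v \<le> L * S u * (v - u)"
  shows "S x * exp (- (L * (y - x))) \<le> S y"
proof -
  define z where "z = - (L * (y - x))"
  have "(\<lambda>m. S x * (1 + z / real m) ^ m) \<longlonglongrightarrow> S x * exp z"
    by (intro tendsto_mult_left tendsto_exp_limit_sequentially)
  \<comment> \<open>For \<open>m\<close> beyond \<open>- z\<close> the factor is nonnegative, so the
    one-step bounds may be multiplied.\<close>
  moreover have "S x * (1 + z / real m) ^ m \<le> S y" if m: "m \<ge> Suc (nat \<lceil>- z\<rceil>)" for m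
  proof -
    define h where "h = (y - x) / real m"
    have m0: "0 < m" using m by simp
    have "- z \<le> real m" using m by linarith
    then have pos: "0 \<le> 1 + z / real m" using m0 by (simp add: field_simps)
    have h: "0 \<le> h" "1 + z / real m = 1 - L * h" using assms(1) by (auto simp: h_def z_def)
    have "S x * (1 + z / real m) ^ i \<le> S (x + real i * h)" if "i \<le> m" for i
      using that
    proof (induction i)
      case (Suc i)
      have "real (Suc i) * h \<le> real m * h" using Suc.prems h by (intro mult_right_mono) auto
      also have "\<dots> = y - x" using m0 by (simp add: h_def)
      finally have "S (x + real i * h) - S (x + real (Suc i) * h) \<le> L * S (x + real i * h) * h"
        using dec[of "x + real i * h" "x + real (Suc i) * h"] h by (simp add: algebra_simps)
      then have "(1 + z / real m) * S (x + real i * h) \<le> S (x + real (Suc i) * h)"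
        unfolding h(2) by (simp add: algebra_simps)
      moreover have "(1 + z / real m) * (S x * (1 + z / real m) ^ i) \<le> (1 + z / real m) * S (x + real i * h)"
        using Suc pos by (intro mult_left_mono) auto
      ultimately show ?case by (simp add: mult_ac)
    qed simp
    from this[of m] show ?thesis using m0 by (simp add: h_def)
  qed
  ultimately show ?thesis unfolding z_def[symmetric]
    by (meson LIMSEQ_le_const2)
qed

text \<open>The mirror image: walking back from \<open>y\<close>, each step multiplies by at least
  \<open>1 + L * h\<close>.\<close>

lemma exp_le_of_decrement_ge:
  fixes S :: "real \<Rightarrow> real"
  assumes "x \<le> y" "0 \<le> L"
    and dec: "\<And>u v. x \<le> u \<Longrightarrow> u \<le> v \<Longrightarrow> v \<le> y \<Longrightarrow> L * S v * (v - u) \<le> S u - S v"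
  shows "S y * exp (L * (y - x)) \<le> S x"
proof -
  define z where "z = L * (y - x)"
  have "(\<lambda>m. S y * (1 + z / real m) ^ m) \<longlonglongrightarrow> S y * exp z"
    by (intro tendsto_mult_left tendsto_exp_limit_sequentially)
  moreover have "S y * (1 + z / real m) ^ m \<le> S x" if m: "m \<ge> Suc 0" for m
  proof -
    define h where "h = (y - x) / real m"
    have m0: "0 < m" using m by simp
    have h: "0 \<le> h" "1 + z / real m = 1 + L * h" using assms(1) by (auto simp: h_def z_def)
    have pos: "0 \<le> 1 + z / real m" using h assms(2) by simp
    have "S y * (1 + z / real m) ^ i \<le> S (y - real i * h)" if "i \<le> m" for i
      using that
    proof (induction i)
      case (Suc i)
      have "real (Suc i) * h \<le> real m * h" using Suc.prems h by (intro mult_right_mono) auto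
      also have "\<dots> = y - x" using m0 by (simp add: h_def)
      finally have "L * S (y - real i * h) * h \<le> S (y - real (Suc i) * h) - S (y - real i * h)"
        using dec[of "y - real (Suc i) * h" "y - real i * h"] h by (simp add: algebra_simps)
      then have "(1 + z / real m) * S (y - real i * h) \<le> S (y - real (Suc i) * h)"
        unfolding h(2) by (simp add: algebra_simps)
      moreover have "(1 + z / real m) * (S y * (1 + z / real m) ^ i) \<le> (1 + z / real m) * S (y - real i * h)"
        using Suc pos by (intro mult_left_mono) auto
      ultimately show ?case by (simp add: mult_ac)
    qed simp
    from this[of m] show ?thesis using m0 by (simp add: h_def)
  qed
  ultimately show ?thesis unfolding z_def[symmetric]
    by (meson LIMSEQ_le_const2)
qed

text \<open>The strict inequality in \<open>dist_fun\<close> makes the complement a closed ray, so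
  an atom at \<open>t\<close> counts as accepting the price \<open>t\<close>.\<close>

lemma one_minus_dist_fun:
  assumes "prob_space F" "sets F = sets borel"
  shows "1 - dist_fun F t = measure F {t..}"
proof -
  interpret prob_space F by fact
  have "space F = UNIV" using sets_eq_imp_space_eq[OF assms(2)] by simp
  then have "{..<t} = space F - {t..}" by auto
  then show ?thesis using prob_compl[of "{t..}"] assms(2) by (simp add: dist_fun_def)
qed

lemma supp_nonneg:
  assumes "prob_space F" "sets F = sets borel" "AE x in F. 0 \<le> x" "x \<in> supp F"
  shows "0 \<le> x"
proof (rule ccontr)
  assume "\<not> 0 \<le> x"
  then have "emeasure F {..<0} > 0" using assms(4) by (auto simp: supp_def)
  moreover have "emeasure F {..<0} = 0"
    using assms(2,3) by (subst (asm) AE_iff_measurable[where N = "{..<0}"])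
      (auto simp: sets_eq_imp_space_eq)
  ultimately show False by simp
qed

text \<open>The hazard rate at \<open>t\<close> separates: it bounds the average rate of decay of the survival function
  on \<open>[0, t]\<close> from above and the one on \<open>[t, r]\<close> from below.\<close>

lemma MHR_survival_ge:
  assumes F: "F \<in> MHR" and r: "r \<in> supp F" "0 < measure F {r..}" and t: "0 \<le> t" "t \<le> r"
  shows "t * ln (measure F {r..}) \<le> r * ln (measure F {t..})"
proof -
  from F obtain f where vd: "valuation_distribution F" and f: "has_density F f"
    and mono: "mono_on (supp_body F) (\<lambda>v. f v / (1 - dist_fun F v))"
    by (auto simp: MHR_def)
  from vd have ps: "prob_space F" and sb: "sets F = sets borel" and nn: "AE x in F. 0 \<le> x"
    and iv: "is_interval (supp F)"
    by (auto simp: valuation_distribution_def)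
  interpret prob_space F by fact
  have sF: "space F = UNIV" using sets_eq_imp_space_eq[OF sb] by simp
  define S where "S x = measure F {x..}" for x
  note S = one_minus_dist_fun[OF ps sb, folded S_def]
  have S_mono: "S y \<le> S x" if "x \<le> y" for x y
    unfolding S_def using that sb by (intro finite_measure_mono) auto
  have S_le_1: "S x \<le> 1" for x by (simp add: S_def)
  have S_eq_1: "S x = 1" if "\<And>z. z < x \<Longrightarrow> z \<notin> supp F" for x
  proof -
    have "{..<x} \<inter> supp F = {}" using that by auto
    then have "emeasure F {..<x} = 0" by (intro emeasure_open_disjoint_supp[OF sb]) auto
    then have "dist_fun F x = 0" by (simp add: dist_fun_def measure_def)
    then show ?thesis using S[of x] by simp
  qed
  have Sr: "0 < S r" using r by (simp add: S_def)
  have "t * ln (S r) \<le> r * ln (S t)"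
  proof (cases "t \<in> supp F \<and> t < r")
    case False
    show ?thesis
    proof (cases "t = r")
      case True then show ?thesis by simp
    next
      case ne: False
      \<comment> \<open>Now \<open>t\<close> lies below the support, hence \<open>S t = 1\<close>
        and the right-hand side is 0, while the left-hand side is not positive.\<close>
      then have "t \<notin> supp F" using False t by simp
      then have "z \<notin> supp F" if "z < t" for z
        using that mem_is_interval_1_I[OF iv _ r(1), of z t] t(2) by auto
      then have "S t = 1" by (rule S_eq_1)
      then show ?thesis using Sr S_le_1[of r] t by (simp add: mult_nonneg_nonpos)
    qed
  next
    case True
    define l where "l = Inf (supp F)"
    have bdd: "bdd_below (supp F)" using supp_nonneg[OF ps sb nn] by (rule bdd_belowI)
    have l: "l \<in> supp F" unfolding l_def using r(1) bdd closed_supp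
      by (intro closed_contains_Inf) auto
    have l0: "0 \<le> l" using supp_nonneg[OF ps sb nn l] .
    have lt: "l \<le> t" unfolding l_def using True bdd by (intro cInf_lower) auto
    have "S l = 1"
    proof (rule S_eq_1)
      show "z \<notin> supp F" if "z < l" for z
        using that cInf_lower[OF _ bdd, of z] by (auto simp: l_def)
    qed
    have body: "w \<in> supp_body F" if "l \<le> w" "w < r" for w
      using that mem_is_interval_1_I[OF iv l r(1)] r(1) by (auto simp: supp_body_def)
    have Spos: "0 < S w" if "w \<le> r" for w using Sr S_mono[OF that] by linarith
    define L where "L = f t / S t"
    have f0: "0 \<le> f w" for w using f by (simp add: has_density_def)
    have L: "0 \<le> L" using f0[of t] Spos[of t] t by (simp add: L_def)
    have [measurable]: "f \<in> borel_measurable borel" using f by (simp add: has_density_def)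
    have hazard: "f w / S w \<le> f w' / S w'" if "l \<le> w" "w \<le> w'" "w' < r" for w w'
      using mono_onD[OF mono body body, of w w'] that by (simp add: S)
    \<comment> \<open>Half-open intervals stay inside \<open>supp_body F\<close> even for
      \<open>v = r\<close>, so a possible atom at \<open>r\<close> is not attributed to the
      density.\<close>
    have diff: "ennreal (S u - S v) = (\<integral>\<^sup>+x\<in>{u..<v}. ennreal (f x) \<partial>lborel)"
      if "l \<le> u" "u \<le> v" "v \<le> r" for u v
    proof -
      have "{u..} = {u..<v} \<union> {v..}" using that by auto
      moreover have "measure F ({u..<v} \<union> {v..}) = measure F {u..<v} + measure F {v..}"
        using sb by (intro finite_measure_Union) auto
      ultimately have "S u = measure F {u..<v} + S v" by (simp add: S_def)
      then have "ennreal (S u - S v) = emeasure F {u..<v}" by (simp add: emeasure_eq_measure)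
      also have "\<dots> = (\<integral>\<^sup>+x\<in>{u..<v}. ennreal (f x) \<partial>lborel)"
        using f that body unfolding has_density_def by (auto simp: subset_eq)
      finally show ?thesis .
    qed
    have const: "(\<integral>\<^sup>+x\<in>{u..<v}. ennreal c \<partial>lborel) = ennreal (c * (v - u))" if "0 \<le> c" "u \<le> v" for u v c :: real
      using that by (subst nn_integral_cmult_indicator) (auto simp: ennreal_mult)
    \<comment> \<open>Up to \<open>t\<close> the hazard rate is at most \<open>L\<close>; from
      \<open>t\<close> on, in the second estimate below, it is at least \<open>L\<close>.\<close>
    have "S l * exp (- (L * (t - l))) \<le> S t"
    proof (rule exp_le_of_decrement_le[OF lt _ L])
      fix u v assume uv: "l \<le> u" "u \<le> v" "v \<le> t"
      have "ennreal (S u - S v) \<le> (\<integral>\<^sup>+x\<in>{u..<v}. ennreal (L * S u) \<partial>lborel)"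
      proof (subst diff)
        show "(\<integral>\<^sup>+x\<in>{u..<v}. ennreal (f x) \<partial>lborel) \<le> (\<integral>\<^sup>+x\<in>{u..<v}. ennreal (L * S u) \<partial>lborel)"
        proof (intro nn_integral_mono)
          fix x
          have "f x \<le> L * S u" if "x \<in> {u..<v}"
          proof -
            have "f x / S x \<le> L" unfolding L_def using that uv True by (intro hazard) auto
            then have "f x \<le> L * S x" using Spos[of x] that uv t by (simp add: field_simps)
            also have "\<dots> \<le> L * S u" using S_mono[of u x] L that by (intro mult_left_mono) auto
            finally show ?thesis .
          qed
          then show "ennreal (f x) * indicator {u..<v} x \<le> ennreal (L * S u) * indicator {u..<v} x"
            by (auto simp: indicator_def intro: ennreal_leI)
        qed
      qed (use uv t in auto)
      also have "\<dots> = ennreal (L * S u * (v - u))"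
        using uv L Spos[of u] t by (intro const) auto
      finally show "S u - S v \<le> L * S u * (v - u)"
        using uv L Spos[of u] t by (subst (asm) ennreal_le_iff) auto
    qed (use \<open>S l = 1\<close> in simp)
    then have "exp (- (L * (t - l))) \<le> S t" using \<open>S l = 1\<close> by simp
    then have A: "- (L * (t - l)) \<le> ln (S t)" using Spos[of t] t by (simp add: ln_ge_iff)
    have "S r * exp (L * (r - t)) \<le> S t"
    proof (rule exp_le_of_decrement_ge[OF t(2) L])
      fix u v assume uv: "t \<le> u" "u \<le> v" "v \<le> r"
      have "ennreal (L * S v * (v - u)) = (\<integral>\<^sup>+x\<in>{u..<v}. ennreal (L * S v) \<partial>lborel)"
        using uv L Spos[of v] by (intro const[symmetric]) auto
      also have "\<dots> \<le> (\<integral>\<^sup>+x\<in>{u..<v}. ennreal (f x) \<partial>lborel)"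
      proof (intro nn_integral_mono)
        fix x
        have "L * S v \<le> f x" if "x \<in> {u..<v}"
        proof -
          have "L \<le> f x / S x" unfolding L_def using that uv lt by (intro hazard) auto
          then have "L * S x \<le> f x" using Spos[of x] that uv by (simp add: field_simps)
          moreover have "L * S v \<le> L * S x" using S_mono[of x v] L that by (intro mult_left_mono) auto
          ultimately show ?thesis by linarith
        qed
        then show "ennreal (L * S v) * indicator {u..<v} x \<le> ennreal (f x) * indicator {u..<v} x"
          by (auto simp: indicator_def intro: ennreal_leI)
      qed
      also have "\<dots> = ennreal (S u - S v)" using uv lt by (intro diff[symmetric]) auto
      finally show "L * S v * (v - u) \<le> S u - S v"
        using S_mono[of u v] uv by (subst (asm) ennreal_le_iff) auto
    qed
    then have "ln (S r * exp (L * (r - t))) \<le> ln (S t)" using Sr Spos[of t] t by (subst ln_le_cancel_iff) auto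
    then have B: "ln (S r) + L * (r - t) \<le> ln (S t)" using Sr by (simp add: ln_mult)
    \<comment> \<open>Weighting this bound by \<open>r - t\<close> and the bound \<open>B\<close> by
      \<open>t\<close> makes the terms in \<open>L\<close> cancel.\<close>
    have "- (L * t) \<le> ln (S t)" using A mult_nonneg_nonneg[OF L l0] by (simp add: algebra_simps)
    then have "(r - t) * (- (L * t)) \<le> (r - t) * ln (S t)" using t by (intro mult_left_mono) auto
    moreover have "t * (ln (S r) + L * (r - t)) \<le> t * ln (S t)" using B t by (intro mult_left_mono) auto
    ultimately show ?thesis by (simp add: algebra_simps)
  qed
  then show ?thesis by (simp add: S_def)
qed

text \<open>On \<open>[0, r]\<close> the survival function dominates the exponential one that agrees
  with it at \<open>r\<close>. As the binomial tail is monotone, it is enough to treat exponential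
  survival functions cut off at \<open>r\<close>, which is what \<open>bound\<close> does.\<close>

lemma MHR_revenue_bound:
  assumes F: "F \<in> MHR" and r: "is_monopoly_reserve F r"
    and bound: "\<And>l r. 0 < l \<Longrightarrow> 0 < r \<Longrightarrow> l * r \<le> 1 \<Longrightarrow>
      ennreal (r * exp (- (l * r))) \<le> (\<integral>\<^sup>+t\<in>{0..r}. ennreal (binomial_tail (n + Suc k) (Suc n) (exp (- (l * t)))) \<partial>lborel)"
  shows "ennreal (r * measure F {r..}) \<le> (\<integral>\<^sup>+t\<in>{0..}. ennreal (binomial_tail (n + Suc k) (Suc n) (measure F {t..})) \<partial>lborel)"
proof -
  from F have ps: "prob_space F" and sb: "sets F = sets borel" and nn: "AE x in F. 0 \<le> x"
    by (auto simp: MHR_def valuation_distribution_def)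
  interpret prob_space F by fact
  let ?S = "\<lambda>t. measure F {t..}" and ?q = "binomial_tail (n + Suc k) (Suc n)"
  have r_supp: "r \<in> supp F" using r by (simp add: is_monopoly_reserve_def)
  then have r0: "0 \<le> r" using supp_nonneg[OF ps sb nn] by auto
  have opt: "p * ?S p \<le> r * ?S r" if "0 \<le> p" for p
    using r that unfolding is_monopoly_reserve_def one_minus_dist_fun[OF ps sb] by auto
  show ?thesis
  proof (cases "r = 0 \<or> ?S r = 0")
    case True then show ?thesis by auto
  next
    case False
    then have pos: "0 < r" "0 < ?S r" using r0 by (auto simp: zero_less_measure_iff)
    define a where "a = - ln (?S r)"
    define l where "l = a / r"
    have "0 \<le> a" using pos by (simp add: a_def)
    then have l: "0 \<le> l" using pos by (simp add: l_def)
    have lr: "l * r = a" using pos by (simp add: l_def)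
    have Sr: "?S r = exp (- a)" using pos by (simp add: a_def)
    have S_ge: "exp (- (l * t)) \<le> ?S t" if "0 \<le> t" "t \<le> r" for t
    proof -
      have "?S r \<le> ?S t" using that sb by (intro finite_measure_mono) auto
      then have "0 < ?S t" using pos by linarith
      moreover have "- (l * t) \<le> ln (?S t)"
        using MHR_survival_ge[OF F r_supp pos(2) that] pos(1) by (simp add: l_def a_def field_simps)
      ultimately show ?thesis by (simp add: ln_ge_iff)
    qed
    \<comment> \<open>Otherwise the lower price \<open>r / a\<close>, where the exponential minorant
      equals \<open>exp (- 1)\<close>, would earn more than \<open>r\<close>: optimality would give
      \<open>exp (a - 1) \<le> a\<close>, which forces \<open>a = 1\<close>.\<close>
    have "a \<le> 1"
    proof (rule ccontr)
      assume "\<not> a \<le> 1"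
      then have a: "1 < a" by simp
      define p where "p = r / a"
      have p: "0 \<le> p" "p \<le> r" "l * p = 1" using a pos by (auto simp: p_def l_def field_simps)
      have "p * exp (- 1) \<le> p * ?S p" using S_ge[OF p(1,2)] p by (intro mult_left_mono) auto
      also have "\<dots> \<le> r * exp (- a)" using opt[OF p(1)] Sr by simp
      finally have "exp (- 1) \<le> a * exp (- a)" using a pos by (simp add: p_def field_simps)
      then have "exp (a - 1) \<le> a" by (simp add: exp_diff exp_minus field_simps)
      then have "a - 1 \<le> ln a" using a by (simp add: ln_ge_iff)
      then have "ln a = a - 1" using ln_le_minus_one[of a] a by simp
      then show False using ln_eq_minus_one[of a] a by simp
    qed
    have "ennreal (r * exp (- a)) \<le> (\<integral>\<^sup>+t\<in>{0..r}. ennreal (?q (exp (- (l * t)))) \<partial>lborel)"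
    proof (cases "a = 0")
      case True
      \<comment> \<open>For \<open>a = 0\<close> the rate is 0 and \<open>bound\<close> does not
        apply, but then the integrand is 1 and both sides are \<open>r\<close>.\<close>
      then show ?thesis using pos by (simp add: l_def binomial_tail_1 del: add_Suc_right)
    next
      case False
      then have "0 < l" using \<open>0 \<le> a\<close> pos by (simp add: l_def)
      then show ?thesis using bound[of l r] pos \<open>a \<le> 1\<close> lr by simp
    qed
    also have "\<dots> \<le> (\<integral>\<^sup>+t\<in>{0..}. ennreal (?q (?S t)) \<partial>lborel)"
    proof (intro nn_integral_mono)
      fix t
      have "?q (exp (- (l * t))) \<le> ?q (?S t)" if "t \<in> {0..r}"
        using S_ge[of t] that l by (intro binomial_tail_mono) auto
      then show "ennreal (?q (exp (- (l * t)))) * indicator {0..r} t \<le> ennreal (?q (?S t)) * indicator {0..} t"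
        by (auto simp: indicator_def intro: ennreal_leI)
    qed
    finally show ?thesis by (simp add: Sr)
  qed
qed

subsection \<open>The upper bound\<close>

text \<open>The left-hand side is the integral of the derivative
  \<open>(1 - l * t) * exp (- (l * t))\<close>, compared pointwise through
  \<open>1 - x \<le> exp (- x)\<close>. Only \<open>s\<close> from \<open>exp (- 1)\<close> on
  occurs because \<open>l * t\<close> is at most 1.\<close>

lemma binomial_tail_integral_ge_of_square_le:
  assumes sq: "\<And>s. exp (- 1) \<le> s \<Longrightarrow> s \<le> 1 \<Longrightarrow> s\<^sup>2 \<le> q s"
    and l: "0 < l" "0 < r" "l * r \<le> 1"
  shows "ennreal (r * exp (- (l * r))) \<le> (\<integral>\<^sup>+t\<in>{0..r}. ennreal (q (exp (- (l * t)))) \<partial>lborel)"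
proof -
  have lt: "l * t \<le> 1" if "t \<le> r" for t
    using mult_left_mono[OF that, of l] l by linarith
  have "ennreal (r * exp (- (l * r))) = (\<integral>\<^sup>+t\<in>{0..r}. ennreal ((1 - l * t) * exp (- (l * t))) \<partial>lborel)"
  proof (subst nn_integral_FTC_Icc[where F = "\<lambda>t. t * exp (- (l * t))"])
    show "((\<lambda>t. t * exp (- (l * t))) has_real_derivative (1 - l * t) * exp (- (l * t))) (at t)" for t
      by (auto intro!: derivative_eq_intros simp: algebra_simps)
  qed (use l lt in auto)
  also have "\<dots> \<le> (\<integral>\<^sup>+t\<in>{0..r}. ennreal (q (exp (- (l * t)))) \<partial>lborel)"
  proof (intro nn_integral_mono)
    fix t
    have "(1 - l * t) * exp (- (l * t)) \<le> q (exp (- (l * t)))" if "t \<in> {0..r}"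
    proof -
      have "(1 - l * t) * exp (- (l * t)) \<le> exp (- (l * t)) * exp (- (l * t))"
        using exp_ge_add_one_self[of "- (l * t)"] by (intro mult_right_mono) auto
      also have "\<dots> \<le> q (exp (- (l * t)))"
        using sq[of "exp (- (l * t))"] that l lt[of t] by (simp add: power2_eq_square)
      finally show ?thesis .
    qed
    then show "ennreal ((1 - l * t) * exp (- (l * t))) * indicator {0..r} t
      \<le> ennreal (q (exp (- (l * t)))) * indicator {0..r} t"
      by (auto simp: indicator_def intro: ennreal_leI)
  qed
  finally show ?thesis .
qed

text \<open>Rescaling prices by \<open>l\<close> reduces the two parameters to
  \<open>a = l * r\<close>.\<close>

lemma binomial_tail_integral_ge_of_expectation_ge:
  assumes ge: "\<And>a. 0 < a \<Longrightarrow> a \<le> 1 \<Longrightarrow> a * exp (- a) \<le> (\<integral>u. min a (- ln u) \<partial>beta_measure n k)"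
    and l: "0 < l" "0 < r" "l * r \<le> 1"
  shows "ennreal (r * exp (- (l * r)))
    \<le> (\<integral>\<^sup>+t\<in>{0..r}. ennreal (binomial_tail (n + Suc k) (Suc n) (exp (- (l * t)))) \<partial>lborel)"
proof -
  define a where "a = l * r"
  have a: "0 < a" "a \<le> 1" using l by (auto simp: a_def)
  have min: "min r (- ln u / l) = min a (- ln u) / l" for u
    using l by (auto simp: min_def a_def field_simps)
  have "r * exp (- (l * r)) = a * exp (- a) / l" using l by (simp add: a_def)
  also have "\<dots> \<le> (\<integral>u. min a (- ln u) \<partial>beta_measure n k) / l"
    using ge[OF a] l by (intro divide_right_mono) auto
  also have "\<dots> = (\<integral>u. min r (- ln u / l) \<partial>beta_measure n k)" unfolding min by simp
  finally have "ennreal (r * exp (- (l * r))) \<le> ennreal (\<integral>u. min r (- ln u / l) \<partial>beta_measure n k)"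
    by (rule ennreal_leI)
  also have "\<dots> = (\<integral>\<^sup>+u. ennreal (min r (- ln u / l)) \<partial>beta_measure n k)"
  proof (rule nn_integral_eq_integral[symmetric])
    show "integrable (beta_measure n k) (\<lambda>u. min r (- ln u / l))"
      unfolding min using a by (intro integrable_divide integrable_min_ln) auto
    show "AE u in beta_measure n k. 0 \<le> min r (- ln u / l)"
      using AE_beta_measure
    proof eventually_elim
      case (elim u)
      then have "0 \<le> - ln u" by simp
      then show ?case using l by (simp only: min_def divide_nonneg_pos split: if_split) auto
    qed
  qed
  finally show ?thesis unfolding nn_integral_binomial_tail_exp(2)[OF l(1)] .
qed

lemma ln_le_half: "0 < x \<Longrightarrow> ln x \<le> x / 2" for x :: real
  using ln_le_minus_one[of "x / 2"] ln_2_less_1 by (simp add: ln_div)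

lemma binomial_tail_integral_ge:
  fixes n :: nat
  defines "K \<equiv> nat \<lceil>(exp (1 / exp 1) - 1) * real n + 1.05 * ln (real n)\<rceil>"
  assumes n: "1 \<le> n" and l: "0 < l" "0 < r" "l * r \<le> 1"
  shows "ennreal (r * exp (- (l * r)))
    \<le> (\<integral>\<^sup>+t\<in>{0..r}. ennreal (binomial_tail (n + K) (Suc n) (exp (- (l * t)))) \<partial>lborel)"
proof -
  define c where "c = exp (1 / exp 1 :: real) - 1"
  have c: "44/100 \<le> c" "c \<le> 45/100" using exp_exp_bounds by (auto simp: c_def)
  define R where "R = c * real n + 1.05 * ln (real n)"
  have "0 \<le> R" using c n by (simp add: R_def)
  then have K: "R \<le> real K" "real K < R + 1"
    unfolding K_def R_def c_def by linarith+
  consider "n = 1" | "n = 2" | "3 \<le> n" using n by linarith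
  then show ?thesis
  proof cases
    case 1
    then have "K = 1" using K c by (simp add: R_def)
    show ?thesis
      by (rule binomial_tail_integral_ge_of_square_le[OF _ l]) (simp add: 1 \<open>K = 1\<close> binomial_tail_def numeral_2_eq_2)
  next
    case 2
    have "ln 2 \<le> (1 :: real)" "2 / 3 \<le> ln (2 :: real)" using ln_2_less_1 ln2_ge_two_thirds by auto
    then have "1 < real K" "real K < 3" using K c 2 by (auto simp: R_def)
    then have "K = 2" by linarith
    \<comment> \<open>The excess over the square is nonnegative for \<open>s\<close> between
      \<open>1 / 3\<close> and 1, and \<open>exp (- 1)\<close> exceeds \<open>1 / 3\<close>.\<close>
    have q: "binomial_tail 4 3 s = s\<^sup>2 + s\<^sup>2 * (1 - s) * (3 * s - 1)" for s
    proof -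
      have "{3..4} = {3, 4 :: nat}" by auto
      then show ?thesis
        by (simp add: binomial_tail_def eval_nat_numeral)
           (simp add: power2_eq_square power3_eq_cube power4_eq_xxxx algebra_simps)
    qed
    show ?thesis
    proof (rule binomial_tail_integral_ge_of_square_le[OF _ l])
      fix s :: real assume s: "exp (- 1) \<le> s" "s \<le> 1"
      have "1 / 3 \<le> s" using s exp_one_inverse_bounds(1) by (simp add: exp_minus inverse_eq_divide)
      then have "0 \<le> s\<^sup>2 * (1 - s) * (3 * s - 1)" using s by simp
      then show "s\<^sup>2 \<le> binomial_tail (n + K) (Suc n) s"
        using q[of s] by (simp add: 2 \<open>K = 2\<close>)
    qed
  next
    case 3
    have "exp 1 \<le> real n" using e_less_272 3 by linarith
    then have ln1: "1 \<le> ln (real n)" using n by (simp add: ln_ge_iff)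
    have "44/100 * real n \<le> c * real n" "c * real n \<le> 45/100 * real n" using c by (intro mult_right_mono; simp)+
    moreover have R: "R = c * real n + 21/20 * ln (real n)" by (simp add: R_def)
    moreover have "3 \<le> real n" using 3 by simp
    ultimately have K': "44/100 * real n + 21/20 * ln (real n) \<le> real K"
      "real K < 45/100 * real n + 21/20 * ln (real n) + 1" "3 \<le> real n"
      using K by linarith+
    have "2 < real K" using K' ln1 by linarith
    then have "K = Suc (Suc (K - 2))" by linarith
    then obtain k where k: "K = Suc (Suc k)" by blast
    \<comment> \<open>Here \<open>k + 1 = K - 1\<close>. For \<open>n = 3\<close> integrality of
      \<open>K\<close> is used, as \<open>K > 2\<close> gives \<open>K \<ge> 3\<close>; from
      \<open>n = 4\<close> on the logarithm is large enough.\<close>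
    have "real n + 1 \<le> 235/100 * (real k + 1)"
    proof (cases "n = 3")
      case True
      then show ?thesis using \<open>2 < real K\<close> k by simp
    next
      case False
      then have "4 \<le> real n" using 3 by simp
      then have "ln 4 \<le> ln (real n)" by simp
      moreover have "ln (4 :: real) = 2 * ln 2" using ln_realpow[of "2 :: real" 2] by simp
      ultimately have "4 / 3 \<le> ln (real n)" using ln2_ge_two_thirds by linarith
      then show ?thesis using K' k \<open>4 \<le> real n\<close> by simp
    qed
    then have small: "real (n + 1) / real (k + 1) \<le> 235/100" by (simp add: divide_simps)
    have "exp (1 / exp 1) * real (n + 1) = real n + c * real n + 1 + c"
      by (simp add: c_def algebra_simps)
    \<comment> \<open>This amounts to \<open>c * n + c + 6/10 \<le> K\<close>. The term
      \<open>1.05 * ln n\<close> pays exactly for \<open>c + 6/10\<close>, since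
      \<open>ln n \<ge> 1\<close> and \<open>c \<le> 45/100\<close>.\<close>
    then have lower: "exp (1 / exp 1) * real (n + 1) + 6/10 \<le> real (n + Suc k + 2)"
      using K(1) R k ln1 c by simp
    have upper: "real (n + Suc k + 2) \<le> 2 * real (n + 1)"
      using K' k ln_le_half[of "real n"] n by simp
    show ?thesis unfolding k
    proof (rule binomial_tail_integral_ge_of_expectation_ge[OF _ l])
      fix a :: real assume a: "0 < a" "a \<le> 1"
      show "a * exp (- a) \<le> (\<integral>u. min a (- ln u) \<partial>beta_measure n (Suc k))"
      proof (cases "a \<le> 7/10")
        case True
        then show ?thesis using a small by (intro expectation_min_ln_ge_small)
      next
        case False
        then show ?thesis using lower upper by (intro expectation_min_ln_ge_large) auto
      qed
    qed
  qed
qed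

lemma RevVCG_ge_RevOPT:
  fixes n :: nat
  defines "K \<equiv> nat \<lceil>(exp (1 / exp 1) - 1) * real n + 1.05 * ln (real n)\<rceil>"
  assumes n: "1 \<le> n" and F: "F \<in> MHR"
  shows "RevOPT n n F \<le> RevVCG n (n + K) F"
proof -
  from F have ps: "prob_space F" and sb: "sets F = sets borel" and nn: "AE x in F. 0 \<le> x"
    and ex: "\<exists>r. is_monopoly_reserve F r"
    by (auto simp: MHR_def valuation_distribution_def)
  from ex have r: "is_monopoly_reserve F (monopoly_reserve F)"
    unfolding monopoly_reserve_def by (rule someI_ex)
  then have r0: "0 \<le> monopoly_reserve F"
    using supp_nonneg[OF ps sb nn] by (auto simp: is_monopoly_reserve_def)
  have "0 < (exp (1 / exp 1) - 1) * real n" using n by simp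
  moreover have "0 \<le> 1.05 * ln (real n)" using n by simp
  ultimately have "0 < K" unfolding K_def by linarith
  then obtain k where k: "K = Suc k" by (cases K) auto
  have lt: "n < n + Suc k" by simp
  have "ennreal (monopoly_reserve F * measure F {monopoly_reserve F..})
      \<le> (\<integral>\<^sup>+t\<in>{0..}. ennreal (binomial_tail (n + Suc k) (Suc n) (measure F {t..})) \<partial>lborel)"
    by (rule MHR_revenue_bound[OF F r]) (rule binomial_tail_integral_ge[OF n, folded K_def, unfolded k])
  then show ?thesis
    unfolding RevOPT_eq[OF ps sb r0] k RevVCG_eq[OF ps sb lt] by (rule mult_left_mono) simp
qed


subsection \<open>The exponential distribution\<close>

definition exponential :: "real measure" where
  "exponential = density lborel (exponential_density 1)"

lemma sets_exponential [simp]: "sets exponential = sets borel"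
  by (simp add: exponential_def)

lemma prob_space_exponential: "prob_space exponential"
  unfolding exponential_def by (rule prob_space_exponential_density) simp

lemma measure_exponential_atLeast: "0 \<le> t \<Longrightarrow> measure exponential {t..} = exp (- t)"
proof -
  assume t: "0 \<le> t"
  have "emeasure exponential {t..} = (\<integral>\<^sup>+x. ennreal (exponential_density 1 x) * indicator {t..} x \<partial>lborel)"
    unfolding exponential_def by (subst emeasure_density) auto
  also have "\<dots> = (\<integral>\<^sup>+x. ennreal (exp (- x)) * indicator {t..} x \<partial>lborel)"
    using t by (intro nn_integral_cong) (auto simp: exponential_density_def indicator_def)
  also have "\<dots> = 0 - (- exp (- t))"
  proof (rule nn_integral_FTC_atLeast)
    show "((\<lambda>x :: real. - exp (- x)) \<longlongrightarrow> 0) at_top"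
      using filterlim_compose[OF exp_at_bot filterlim_uminus_at_bot_at_top]
      by (subst tendsto_minus_cancel_left[symmetric]) simp
  qed (auto intro!: derivative_eq_intros)
  finally show ?thesis by (simp add: measure_def)
qed

lemma AE_exponential: "AE x in exponential. 0 \<le> x"
  unfolding exponential_def by (subst AE_density) (auto simp: exponential_density_def)

lemma supp_exponential: "supp exponential = {0..}"
proof (intro set_eqI iffI)
  fix x assume "x \<in> supp exponential"
  then show "x \<in> {0..}"
    using supp_nonneg[OF prob_space_exponential sets_exponential AE_exponential] by simp
next
  interpret prob_space exponential by (rule prob_space_exponential)
  fix x :: real assume x: "x \<in> {0..}"
  show "x \<in> supp exponential"
    unfolding supp_def
  proof (intro CollectI allI impI)
    fix U :: "real set" assume "open U \<and> x \<in> U"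
    then obtain e where e: "0 < e" "ball x e \<subseteq> U" and U: "U \<in> sets borel"
      by (auto simp: open_contains_ball)
    have "{x..} = {x..<x + e} \<union> {x + e..}" using e by auto
    moreover have "prob ({x..<x + e} \<union> {x + e..}) = prob {x..<x + e} + prob {x + e..}"
      by (intro finite_measure_Union) auto
    ultimately have "prob {x..<x + e} = exp (- x) - exp (- (x + e))"
      using x e measure_exponential_atLeast[of x] measure_exponential_atLeast[of "x + e"] by simp
    also have "\<dots> > 0" using e by simp
    finally have "0 < prob {x..<x + e}" .
    also have "prob {x..<x + e} \<le> prob U"
      using e U by (intro finite_measure_mono) (auto simp: subset_eq dist_real_def)
    finally show "0 < emeasure exponential U" by (simp add: emeasure_eq_measure)
  qed
qed

text \<open>The hazard rate is constantly 1, and \<open>t * exp (- t)\<close> is maximal at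
  \<open>t = 1\<close>.\<close>

lemma exponential_MHR: "exponential \<in> MHR"
proof -
  have S: "1 - dist_fun exponential t = exp (- t)" if "0 \<le> t" for t
    using one_minus_dist_fun[OF prob_space_exponential sets_exponential] measure_exponential_atLeast[OF that] by simp
  have body: "supp_body exponential = {0..}"
  proof -
    have "\<exists>y\<in>{0..}. x < y" if "0 \<le> x" for x :: real
      using that by (intro bexI[of _ "x + 1"]) auto
    then show ?thesis by (auto simp: supp_body_def supp_exponential)
  qed
  have "has_density exponential (exponential_density 1)"
    unfolding has_density_def exponential_def by (auto simp: emeasure_density)
  moreover have "is_monopoly_reserve exponential 1"
    using mult_exp_minus_le by (auto simp: is_monopoly_reserve_def supp_exponential S exp_minus inverse_eq_divide)
  moreover have "mono_on (supp_body exponential) (\<lambda>v. exponential_density 1 v / (1 - dist_fun exponential v))"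
    by (auto simp: body S mono_on_def exponential_density_def)
  ultimately show ?thesis
    using prob_space_exponential AE_exponential
    by (auto simp: MHR_def valuation_distribution_def supp_exponential is_interval_1)
qed

text \<open>The optimal revenue is at least that of price 1, namely \<open>n / e\<close>, while
  Jensen bounds VCG by \<open>n * ln ((n + k) / n)\<close>. Comparing and exponentiating gives the
  claim.\<close>

lemma exponential_extra_buyers_ge:
  assumes n: "1 \<le> n" and le: "RevOPT n n exponential \<le> RevVCG n (n + k) exponential"
  shows "(exp (1 / exp 1) - 1) * real n \<le> real k"
proof -
  note ps = prob_space_exponential
  let ?r = "monopoly_reserve exponential"
  have "\<exists>r. is_monopoly_reserve exponential r"
    using exponential_MHR by (simp add: MHR_def valuation_distribution_def)
  then have "is_monopoly_reserve exponential ?r"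
    unfolding monopoly_reserve_def by (rule someI_ex)
  then have r: "0 \<le> ?r" and "1 * (1 - dist_fun exponential 1) \<le> ?r * (1 - dist_fun exponential ?r)"
    unfolding is_monopoly_reserve_def supp_exponential by (auto dest: spec[of _ 1])
  then have "exp (- 1) \<le> ?r * measure exponential {?r..}"
    unfolding one_minus_dist_fun[OF ps sets_exponential] by (simp add: measure_exponential_atLeast)
  then have "of_nat n * ennreal (exp (- 1)) \<le> RevOPT n n exponential"
    unfolding RevOPT_eq[OF ps sets_exponential r] by (intro mult_left_mono ennreal_leI) auto
  then have ge: "of_nat n * ennreal (exp (- 1)) \<le> RevVCG n (n + k) exponential"
    using le by (rule order_trans)
  show ?thesis
  proof (cases k)
    case 0
    then show ?thesis using ge n by (simp add: RevVCG_balanced)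
  next
    case (Suc j)
    \<comment> \<open>The Jensen bound needs a successor as first index; in these terms
      \<open>m + 1 = n\<close> and \<open>m + j + 2 = n + k\<close>.\<close>
    obtain m where m: "n = Suc m" using n by (cases n) auto
    define L where "L = ln (real (m + j + 2) / real (m + 1))"
    have "RevVCG n (n + k) exponential = of_nat n *
        (\<integral>\<^sup>+t\<in>{0..}. ennreal (binomial_tail (n + Suc j) (Suc n) (exp (- (1 * t)))) \<partial>lborel)"
    proof -
      have "(\<integral>\<^sup>+t\<in>{0..}. ennreal (binomial_tail (n + Suc j) (Suc n) (measure exponential {t..})) \<partial>lborel)
        = (\<integral>\<^sup>+t\<in>{0..}. ennreal (binomial_tail (n + Suc j) (Suc n) (exp (- (1 * t)))) \<partial>lborel)"
        by (intro nn_integral_cong) (auto simp: measure_exponential_atLeast indicator_def)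
      moreover have lt: "n < n + Suc j" by simp
      ultimately show ?thesis
        unfolding Suc by (simp only: RevVCG_eq[OF ps sets_exponential lt])
    qed
    also have "\<dots> \<le> of_nat n * ennreal L"
      unfolding nn_integral_binomial_tail_exp(1)[OF zero_less_one]
      using nn_integral_ln_beta_measure_le[of m j] by (intro mult_left_mono) (auto simp: m L_def)
    finally have "ennreal (real n * exp (- 1)) \<le> ennreal (real n * L)"
      using ge by (simp add: ennreal_mult' ennreal_of_nat_eq_real_of_nat)
    moreover have "0 \<le> L" by (auto simp: L_def)
    ultimately have "exp (- 1) \<le> L" using n by (subst (asm) ennreal_le_iff) auto
    then have "exp (1 / exp 1) \<le> real (m + j + 2) / real (m + 1)"
      by (simp add: L_def ln_ge_iff exp_minus inverse_eq_divide)
    then show ?thesis using m Suc by (simp add: field_simps)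
  qed
qed

theorem theorem3p2:
  fixes n :: nat
  assumes "n \<ge> 1"
  shows "ereal ((exp 1 powr (1 / exp 1) - 1) * real n) \<le> ereal_of_enat (CC n MHR) \<and>
         ereal_of_enat (CC n MHR)
           \<le> ereal (real_of_int \<lceil>(exp 1 powr (1 / exp 1) - 1) * real n + 1.05 * ln (real n)\<rceil>)"
proof -
  define A where "A = {k. \<forall>F \<in> MHR. RevVCG n (n + k) F \<ge> RevOPT n n F}"
  define R where "R = (exp (1 / exp 1) - 1) * real n + 1.05 * ln (real n)"
  have e: "exp 1 powr (1 / exp 1) = exp (1 / exp 1 :: real)" by (simp add: powr_def)
  have "44/100 \<le> exp (1 / exp 1) - (1 :: real)" using exp_exp_bounds by simp
  then have "0 \<le> R" using assms by (auto simp: R_def)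
  have K: "nat \<lceil>R\<rceil> \<in> A"
    unfolding A_def R_def using RevVCG_ge_RevOPT[OF assms] by simp
  \<comment> \<open>The infimum is attained, so the lower bound for members of \<open>A\<close>
    applies to it.\<close>
  have "CC n MHR \<in> enat ` A"
    unfolding CC_def A_def[symmetric] using K by (intro wellorder_InfI[of "enat (nat \<lceil>R\<rceil>)"]) auto
  then obtain k where k: "CC n MHR = enat k" "k \<in> A" by auto
  have "k \<le> nat \<lceil>R\<rceil>"
    using K k(1) unfolding CC_def A_def[symmetric] by (metis Inf_lower enat_ord_simps(1) imageI)
  then have "real k \<le> real_of_int \<lceil>R\<rceil>" using \<open>0 \<le> R\<close> by linarith
  moreover have "(exp (1 / exp 1) - 1) * real n \<le> real k"
    using k(2) exponential_MHR exponential_extra_buyers_ge[OF assms] by (auto simp: A_def)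
  ultimately show ?thesis unfolding e k(1) R_def by simp
qed

end
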